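(* Let $B$ be a skew brace. Then $B$ is a $\theta_f$-skew brace and every $\lambda_b$ ($b\in B$) has finite order if and only if the following two conditions hold: (i) every element of $B$ is contained in a strong left ideal of $B$ that is finitely generated as a skew brace; (ii) every element of $B/\operatorname{Soc}(B)$ is contained in a finite strong left ideal of $B/\operatorname{Soc}(B)$.
   Context: A skew brace is a triple $(B,+,\circ)$ where $(B,+)$ and $(B,\circ)$ are (not necessarily abelian) groups with $a\circ(b+c)=a\circ b-a+a\circ c$ for all $a,b,c\in B$, where $-a$ is the inverse of $a$ in $(B,+)$ and $\circ$ takes precedence over $+$. Put $\lambda_a(b)=-a+a\circ b$; then $\lambda:(B,\circ)\to\operatorname{Aut}(B,+)$, $a\mapsto\lambda_a$, is a group homomorphism, and the order of $\lambda_b$ is its order in $\operatorname{Aut}(B,+)$. Put $\theta_{(a,b)}(c)=a+\lambda_b(c)-a$. $B$ is a $\theta_f$-skew brace if for every $x\in B$ the set $[x]_\theta=\{\theta_{(a,b)}(x): a,b\in B\}$ is finite. A strong left ideal is a normal subgroup $L$ of $(B,+)$ with $\lambda_b(L)=L$ for all $b\in B$; an ideal is a strong left ideal that is also normal in $(B,\circ)$, and quotients by ideals are skew braces. The socle $\operatorname{Soc}(B)=\ker\lambda\cap Z(B,+)$ is an ideal of $B$. A sub skew brace is a subset that is a subgroup of both $(B,+)$ and $(B,\circ)$ (every strong left ideal is one); a skew brace is finitely generated as a skew brace if it is the smallest sub skew brace containing some finite subset. *)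

theory Defs
  imports "HOL-Algebra.Algebra"
begin

text \<open>
  Skew braces use the ring records of \<open>HOL-Algebra\<close>: \<open>\<oplus>\<close> is the (not necessarily
  commutative) group operation \<open>+\<close>, with \<open>(B, +) = add_monoid B\<close>, and \<open>\<otimes>\<close> is the group
  operation \<open>\<circ>\<close>. The record has separate neutral elements \<open>\<zero>\<close> and \<open>\<one>\<close>; they coincide,
  see \<open>one_eq_zero\<close> below.
\<close>

locale skew_brace = group B + add: group "add_monoid B" for B :: "('a, 'm) ring_scheme" (structure) +
  assumes brace: "\<lbrakk>a \<in> carrier B; b \<in> carrier B; c \<in> carrier B\<rbrakk>
    \<Longrightarrow> a \<otimes> (b \<oplus> c) = ((a \<otimes> b) \<ominus> a) \<oplus> (a \<otimes> c)"

text \<open>Restricted to the carrier, since the elements of \<open>AutoGroup\<close> are extensional functions.\<close>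

definition lam :: "('a, 'm) ring_scheme \<Rightarrow> 'a \<Rightarrow> 'a \<Rightarrow> 'a" where
  "lam B a = (\<lambda>b \<in> carrier B. \<ominus>\<^bsub>B\<^esub> a \<oplus>\<^bsub>B\<^esub> (a \<otimes>\<^bsub>B\<^esub> b))"

text \<open>\<open>group.ord\<close> is \<open>0\<close> on elements of infinite order.\<close>

definition lam_finite_order :: "('a, 'm) ring_scheme \<Rightarrow> 'a \<Rightarrow> bool" where
  "lam_finite_order B b \<longleftrightarrow> group.ord (AutoGroup (add_monoid B)) (lam B b) \<noteq> 0"

definition theta :: "('a, 'm) ring_scheme \<Rightarrow> 'a \<Rightarrow> 'a \<Rightarrow> 'a \<Rightarrow> 'a" where
  "theta B a b c = (a \<oplus>\<^bsub>B\<^esub> lam B b c) \<ominus>\<^bsub>B\<^esub> a"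

definition theta_class :: "('a, 'm) ring_scheme \<Rightarrow> 'a \<Rightarrow> 'a set" where
  "theta_class B x = {theta B a b x | a b. a \<in> carrier B \<and> b \<in> carrier B}"

definition theta_f_skew_brace :: "('a, 'm) ring_scheme \<Rightarrow> bool" where
  "theta_f_skew_brace B \<longleftrightarrow> skew_brace B \<and> (\<forall>x \<in> carrier B. finite (theta_class B x))"

definition strong_left_ideal :: "'a set \<Rightarrow> ('a, 'm) ring_scheme \<Rightarrow> bool" where
  "strong_left_ideal L B \<longleftrightarrow>
     L \<lhd> add_monoid B \<and> (\<forall>b \<in> carrier B. lam B b ` L = L)"

definition skew_brace_ideal :: "'a set \<Rightarrow> ('a, 'm) ring_scheme \<Rightarrow> bool" where
  "skew_brace_ideal I B \<longleftrightarrow> strong_left_ideal I B \<and> I \<lhd> B"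

definition socle :: "('a, 'm) ring_scheme \<Rightarrow> 'a set" where
  "socle B = kernel B (AutoGroup (add_monoid B)) (lam B) \<inter>
     {z \<in> carrier B. \<forall>x \<in> carrier B. z \<oplus>\<^bsub>B\<^esub> x = x \<oplus>\<^bsub>B\<^esub> z}"

definition sub_skew_brace :: "'a set \<Rightarrow> ('a, 'm) ring_scheme \<Rightarrow> bool" where
  "sub_skew_brace S B \<longleftrightarrow> subgroup S (add_monoid B) \<and> subgroup S B"

definition sub_skew_brace_generated :: "('a, 'm) ring_scheme \<Rightarrow> 'a set \<Rightarrow> 'a set" where
  "sub_skew_brace_generated B F = \<Inter>{S. sub_skew_brace S B \<and> F \<subseteq> S}"

definition finitely_generated_skew_brace :: "('a, 'm) ring_scheme \<Rightarrow> bool" where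
  "finitely_generated_skew_brace B \<longleftrightarrow> skew_brace B \<and>
     (\<exists>F. finite F \<and> F \<subseteq> carrier B \<and> sub_skew_brace_generated B F = carrier B)"


text \<open>
  The quotient of a skew brace by an ideal \<open>I\<close> is \<open>B Quot I\<close>: its elements are the cosets
  \<open>I + x\<close>, and its operations are those induced by \<open>B\<close>. The lemmas below check that
  this construction from ring theory is correct for skew braces.
\<close>

context skew_brace
begin

lemma a_facts:
  shows a_closed: "\<lbrakk>x \<in> carrier B; y \<in> carrier B\<rbrakk> \<Longrightarrow> x \<oplus> y \<in> carrier B"
    and z_closed: "\<zero> \<in> carrier B"
    and n_closed: "x \<in> carrier B \<Longrightarrow> \<ominus> x \<in> carrier B"
    and a_ass: "\<lbrakk>x \<in> carrier B; y \<in> carrier B; z \<in> carrier B\<rbrakk>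
      \<Longrightarrow> (x \<oplus> y) \<oplus> z = x \<oplus> (y \<oplus> z)"
    and lz: "x \<in> carrier B \<Longrightarrow> \<zero> \<oplus> x = x"
    and rz: "x \<in> carrier B \<Longrightarrow> x \<oplus> \<zero> = x"
    and ln: "x \<in> carrier B \<Longrightarrow> \<ominus> x \<oplus> x = \<zero>"
    and rn: "x \<in> carrier B \<Longrightarrow> x \<oplus> \<ominus> x = \<zero>"
    and lcan: "\<lbrakk>x \<in> carrier B; y \<in> carrier B; z \<in> carrier B\<rbrakk>
      \<Longrightarrow> x \<oplus> y = x \<oplus> z \<longleftrightarrow> y = z"
  using add.m_closed[of x y] add.one_closed add.inv_closed[of x] add.m_assoc[of x y z]
    add.l_one[of x] add.r_one[of x] add.l_inv[of x] add.r_inv[of x] add.l_cancel[of x y z]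
  by (auto simp add: a_inv_def)

lemmas a_simps = a_closed z_closed n_closed lz rz ln rn

lemma ln2: "\<lbrakk>x \<in> carrier B; y \<in> carrier B\<rbrakk> \<Longrightarrow> \<ominus> x \<oplus> (x \<oplus> y) = y"
  by (simp add: a_ass[symmetric] a_simps)

lemma rn2: "\<lbrakk>x \<in> carrier B; y \<in> carrier B\<rbrakk> \<Longrightarrow> x \<oplus> (\<ominus> x \<oplus> y) = y"
  by (simp add: a_ass[symmetric] a_simps)

lemma one_eq_zero: "\<one> = \<zero>"
  using brace[of "\<one>" "\<zero>" "\<zero>"] lcan[of "\<ominus> \<one>" "\<zero>" "\<one>"]
  by (simp add: a_simps a_minus_def)
     (metis a_simps one_closed)

lemma lam_eq: "b \<in> carrier B \<Longrightarrow> lam B a b = \<ominus> a \<oplus> (a \<otimes> b)"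
  by (simp add: lam_def)

lemma mult_eq: "\<lbrakk>a \<in> carrier B; b \<in> carrier B\<rbrakk> \<Longrightarrow> a \<otimes> b = a \<oplus> lam B a b"
  by (simp add: lam_eq rn2)

lemma lam_closed: "\<lbrakk>a \<in> carrier B; b \<in> carrier B\<rbrakk> \<Longrightarrow> lam B a b \<in> carrier B"
  by (simp add: lam_eq a_simps)

lemma lam_add: "\<lbrakk>a \<in> carrier B; b \<in> carrier B; c \<in> carrier B\<rbrakk>
    \<Longrightarrow> lam B a (b \<oplus> c) = lam B a b \<oplus> lam B a c"
  by (simp add: lam_eq brace a_minus_def a_ass a_simps)

lemma lam_mult: "\<lbrakk>a \<in> carrier B; b \<in> carrier B; c \<in> carrier B\<rbrakk>
    \<Longrightarrow> lam B (a \<otimes> b) c = lam B a (lam B b c)"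
proof -
  assume c: "a \<in> carrier B" "b \<in> carrier B" "c \<in> carrier B"
  have "(a \<otimes> b) \<oplus> lam B (a \<otimes> b) c = a \<otimes> (b \<otimes> c)"
    using c by (simp add: mult_eq[symmetric] m_assoc)
  also have "\<dots> = a \<oplus> lam B a (b \<oplus> lam B b c)"
    using c by (simp add: mult_eq lam_closed a_simps)
  also have "\<dots> = (a \<otimes> b) \<oplus> lam B a (lam B b c)"
    using c by (simp add: mult_eq lam_add lam_closed a_simps a_ass)
  finally show ?thesis using c by (simp add: lcan lam_closed)
qed

lemma lam_one: "x \<in> carrier B \<Longrightarrow> lam B \<one> x = x"
  using ln2[of \<zero> x] by (simp add: lam_eq one_eq_zero[symmetric]) (metis lz one_eq_zero one_closed)

lemma lam_hom: "lam B \<in> hom B (AutoGroup (add_monoid B))"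
proof -
  have bij: "bij_betw (lam B a) (carrier B) (carrier B)" if a: "a \<in> carrier B" for a
    by (rule bij_betw_byWitness[where f' = "lam B (inv a)"])
       (use a in \<open>auto simp: lam_mult[symmetric] lam_one lam_closed\<close>)
  have aut: "lam B a \<in> auto (add_monoid B)" if a: "a \<in> carrier B" for a
    using a bij[OF a] by (auto simp: auto_def hom_def Bij_def lam_closed lam_add) (simp add: lam_def)
  show ?thesis
    by (rule homI)
       (auto simp: AutoGroup_def BijGroup_def aut auto_def[THEN eqset_imp_iff, THEN iffD1, OF aut]
          compose_def lam_mult fun_eq_iff,
        use aut in \<open>auto simp: auto_def lam_def\<close>)
qed

lemma r_coset_add_mult:
  assumes I: "skew_brace_ideal I B" and x: "x \<in> carrier B"
  shows "I +> x = I #> x"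
proof -
  have nA: "I \<lhd> add_monoid B" and nM: "I \<lhd> B" and lI: "lam B x ` I = I"
    using I x by (auto simp: skew_brace_ideal_def strong_left_ideal_def)
  have sub: "I \<subseteq> carrier B"
    using nM by (simp add: normal_imp_subgroup subgroup.subset)
  have "I +> x = (\<lambda>i. x \<oplus> i) ` (lam B x ` I)"
    using normal.coset_eq[OF nA] x lI by (auto simp: a_r_coset_def l_coset_def)
  also have "\<dots> = (\<lambda>i. x \<otimes> i) ` I"
    using sub x by (force simp: image_image mult_eq)
  also have "\<dots> = I #> x"
    using normal.coset_eq[OF nM] x by (auto simp: l_coset_def)
  finally show ?thesis .
qed

lemma quot_add:
  assumes I: "skew_brace_ideal I B" and "x \<in> carrier B" "y \<in> carrier B"
  shows "(I +> x) \<oplus>\<^bsub>B Quot I\<^esub> (I +> y) = I +> (x \<oplus> y)"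
  using normal.rcos_sum[of I "add_monoid B" x y] assms
  by (simp add: FactRing_def set_add_def a_r_coset_def skew_brace_ideal_def strong_left_ideal_def)

lemma quot_mult:
  assumes I: "skew_brace_ideal I B" and x: "x \<in> carrier B" and y: "y \<in> carrier B"
  shows "(I +> x) \<otimes>\<^bsub>B Quot I\<^esub> (I +> y) = I +> (x \<otimes> y)"
proof -
  have nM: "I \<lhd> B" using I by (simp add: skew_brace_ideal_def)
  have sM: "subgroup I B" using nM by (rule normal_imp_subgroup)
  have *: "I +> (a \<otimes> b) = I +> (x \<otimes> y)" if a: "a \<in> I #> x" and b: "b \<in> I #> y" for a b
  proof -
    have ab: "a \<in> carrier B" "b \<in> carrier B"
      using a b x y sM by (meson r_coset_subset_G subgroup.subset subsetD)+
    have "a \<otimes> b \<in> (I #> x) <#> (I #> y)" using a b by (auto simp: set_mult_def)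
    then have "a \<otimes> b \<in> I #> (x \<otimes> y)" using normal.rcos_sum[OF nM x y] by simp
    then have "I #> (a \<otimes> b) = I #> (x \<otimes> y)"
      using repr_independence[OF _ _ sM] x y by (metis m_closed)
    then show ?thesis using r_coset_add_mult[OF I] ab x y by simp
  qed
  have "x \<in> I #> x" "y \<in> I #> y" using rcos_self[OF _ sM] x y by auto
  then show ?thesis
    using * r_coset_add_mult[OF I] x y by (auto simp: FactRing_def rcoset_mult_def)
qed

lemma quot_carrier: "carrier (B Quot I) = (\<lambda>x. I +> x) ` carrier B"
  by (auto simp: FactRing_def A_RCOSETS_def')

lemma quot_zero:
  assumes I: "skew_brace_ideal I B"
  shows "\<zero>\<^bsub>B Quot I\<^esub> = I +> \<zero>" and "\<one>\<^bsub>B Quot I\<^esub> = I +> \<zero>"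
proof -
  have "I \<subseteq> carrier B"
    using I normal_imp_subgroup subgroup.subset unfolding skew_brace_ideal_def by blast
  then show "\<zero>\<^bsub>B Quot I\<^esub> = I +> \<zero>"
    using add.coset_mult_one[of I] by (simp add: FactRing_def a_r_coset_def)
  show "\<one>\<^bsub>B Quot I\<^esub> = I +> \<zero>" by (simp add: FactRing_def one_eq_zero)
qed

lemma quot_skew_brace:
  assumes I: "skew_brace_ideal I B"
  shows "skew_brace (B Quot I)"
proof -
  note q = quot_add[OF I] quot_mult[OF I] quot_zero[OF I]
  have gM: "group (B Quot I)"
  proof (rule Group.groupI)
    fix C assume "C \<in> carrier (B Quot I)"
    then obtain x where x: "x \<in> carrier B" "C = I +> x" by (auto simp: quot_carrier)
    then have "(I +> inv x) \<otimes>\<^bsub>B Quot I\<^esub> C = \<one>\<^bsub>B Quot I\<^esub>" by (simp add: q one_eq_zero)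
    then show "\<exists>D\<in>carrier (B Quot I). D \<otimes>\<^bsub>B Quot I\<^esub> C = \<one>\<^bsub>B Quot I\<^esub>"
      using x by (auto simp: quot_carrier)
  qed (auto simp: quot_carrier q m_assoc one_eq_zero[symmetric])
  have neg: "(I +> \<ominus> x) \<oplus>\<^bsub>B Quot I\<^esub> (I +> x) = \<zero>\<^bsub>B Quot I\<^esub>" if "x \<in> carrier B" for x
    using that by (simp add: q a_simps)
  interpret qa: group "add_monoid (B Quot I)"
  proof (rule Group.groupI)
    fix C assume "C \<in> carrier (add_monoid (B Quot I))"
    then show "\<exists>D\<in>carrier (add_monoid (B Quot I)).
        D \<otimes>\<^bsub>add_monoid (B Quot I)\<^esub> C = \<one>\<^bsub>add_monoid (B Quot I)\<^esub>"
      using neg n_closed by (auto simp: quot_carrier)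
  qed (auto simp: quot_carrier q a_ass a_simps)
  have inv: "\<ominus>\<^bsub>B Quot I\<^esub> (I +> x) = I +> \<ominus> x" if "x \<in> carrier B" for x
    using qa.inv_equality[of "I +> \<ominus> x" "I +> x"] neg[OF that] that
    by (simp add: a_inv_def[of "B Quot I"] quot_carrier n_closed)
  show ?thesis
    by (intro skew_brace.intro gM qa.group_axioms skew_brace_axioms.intro)
       (auto simp: quot_carrier q inv a_minus_def a_simps brace)
qed

lemma socle_eq:
  "socle B = {z \<in> carrier B. (\<forall>x \<in> carrier B. lam B z x = x) \<and>
     (\<forall>x \<in> carrier B. z \<oplus> x = x \<oplus> z)}"
  by (auto simp: socle_def kernel_def AutoGroup_def BijGroup_def fun_eq_iff lam_def restrict_def)

lemma socle_conj:
  assumes z: "z \<in> socle B" and b: "b \<in> carrier B"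
  shows "b \<otimes> z \<otimes> inv b = lam B b z" and "lam B b z \<in> socle B"
proof -
  have zc: "z \<in> carrier B" and zl: "\<And>x. x \<in> carrier B \<Longrightarrow> lam B z x = x"
    and za: "\<And>x. x \<in> carrier B \<Longrightarrow> z \<oplus> x = x \<oplus> z"
    using z by (auto simp: socle_eq)
  define u where "u = b \<otimes> z \<otimes> inv b"
  have uc: "u \<in> carrier B" using b zc by (simp add: u_def)
  have ul: "lam B u x = x" if "x \<in> carrier B" for x
  proof -
    have "lam B u x = lam B b (lam B (inv b) x)"
      unfolding u_def using that b zc by (simp add: lam_mult lam_closed zl)
    also have "\<dots> = x" using that b by (simp add: lam_mult[symmetric] lam_one)
    finally show ?thesis .
  qed
  have wa: "lam B b z \<oplus> x = x \<oplus> lam B b z" if "x \<in> carrier B" for x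
  proof -
    define y where "y = lam B (inv b) x"
    have y: "y \<in> carrier B" "x = lam B b y"
      using that b by (auto simp: y_def lam_closed lam_mult[symmetric] lam_one)
    then show ?thesis using lam_add[OF b zc y(1)] lam_add[OF b y(1) zc] za by simp
  qed
  have "u \<oplus> b = u \<otimes> b" using uc b by (simp add: mult_eq ul)
  also have "\<dots> = b \<otimes> z" unfolding u_def using b zc by (simp add: m_assoc)
  also have "\<dots> = lam B b z \<oplus> b" using b zc by (simp add: mult_eq wa)
  finally have "u = lam B b z"
    using add.r_cancel[of u b "lam B b z"] uc b zc by (simp add: lam_closed)
  then show "b \<otimes> z \<otimes> inv b = lam B b z" "lam B b z \<in> socle B"
    using uc ul wa by (auto simp: u_def socle_eq)
qed

lemma socle_ideal: "skew_brace_ideal (socle B) B"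
proof -
  have sub: "socle B \<subseteq> carrier B" by (auto simp: socle_eq)
  have zl: "lam B z x = x" "z \<oplus> x = x \<oplus> z" if "z \<in> socle B" "x \<in> carrier B" for z x
    using that by (auto simp: socle_eq)
  have mult_add: "z \<otimes> x = z \<oplus> x" if "z \<in> socle B" "x \<in> carrier B" for z x
    using that sub by (auto simp: mult_eq zl)
  have one: "\<one> \<in> socle B"
    using lz rz by (auto simp: socle_eq lam_one one_eq_zero[symmetric])
  have mult: "z \<otimes> w \<in> socle B" if "z \<in> socle B" "w \<in> socle B" for z w
  proof -
    have c: "z \<in> carrier B" "w \<in> carrier B" using that sub by auto
    have "(z \<oplus> w) \<oplus> x = x \<oplus> (z \<oplus> w)" if x: "x \<in> carrier B" for x
    proof -
      have "(z \<oplus> w) \<oplus> x = (z \<oplus> x) \<oplus> w"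
        using c x \<open>w \<in> socle B\<close> by (simp add: a_ass zl(2)[of w x])
      then show ?thesis using c x \<open>z \<in> socle B\<close> by (simp add: a_ass zl(2)[of z x])
    qed
    then have "(z \<otimes> w) \<oplus> x = x \<oplus> (z \<otimes> w)" if x: "x \<in> carrier B" for x
      using x mult_add[OF \<open>z \<in> socle B\<close> c(2)] c by simp
    then show ?thesis using c that by (simp add: socle_eq lam_mult)
  qed
  have inv_neg: "inv z = \<ominus> z" if z: "z \<in> socle B" for z
  proof -
    have c: "z \<in> carrier B" using z sub by auto
    have "z \<otimes> \<ominus> z = \<one>" using mult_add[OF z, of "\<ominus> z"] c by (simp add: a_simps one_eq_zero)
    then show ?thesis using c by (metis inv_equality inv_inv n_closed)
  qed
  have neg: "\<ominus> z \<in> socle B" if z: "z \<in> socle B" for z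
  proof -
    have c: "z \<in> carrier B" using z sub by auto
    have 1: "lam B (\<ominus> z) x = x" if x: "x \<in> carrier B" for x
    proof -
      have "lam B (inv z) x = lam B (inv z) (lam B z x)" using z x by (simp add: zl)
      also have "\<dots> = x" using c x by (simp add: lam_mult[symmetric] lam_one)
      finally show ?thesis using inv_neg[OF z] by simp
    qed
    have 2: "\<ominus> z \<oplus> x = x \<oplus> \<ominus> z" if x: "x \<in> carrier B" for x
    proof -
      have "z \<oplus> (\<ominus> z \<oplus> x) = z \<oplus> (x \<oplus> \<ominus> z)"
        using c x z by (simp add: rn2 a_ass[symmetric] a_simps zl(2)[of z x])
                       (simp add: a_ass a_simps)
      then show ?thesis using c x by (simp add: lcan a_simps)
    qed
    show ?thesis using 1 2 c by (simp add: socle_eq n_closed)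
  qed
  have sM: "subgroup (socle B) B"
    using sub one mult neg inv_neg by (intro subgroup.intro) auto
  have sA: "subgroup (socle B) (add_monoid B)"
  proof (rule subgroup.intro)
    fix x y assume xy: "x \<in> socle B" "y \<in> socle B"
    then show "x \<otimes>\<^bsub>add_monoid B\<^esub> y \<in> socle B"
      using mult[OF xy] mult_add[OF xy(1), of y] sub by auto
  next
    fix x assume "x \<in> socle B"
    then show "inv\<^bsub>add_monoid B\<^esub> x \<in> socle B" using neg[of x] by (simp add: a_inv_def)
  qed (use sub one one_eq_zero in auto)
  have nM: "socle B \<lhd> B"
    unfolding normal_inv_iff using sM socle_conj by auto
  have nA: "socle B \<lhd> add_monoid B"
    unfolding add.normal_inv_iff
  proof (intro conjI ballI sA)
    fix x z assume "x \<in> carrier (add_monoid B)" "z \<in> socle B"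
    moreover from this have "x \<oplus> z \<oplus> \<ominus> x = z"
      using sub zl(2)[of z x, symmetric] by (auto simp: a_ass a_simps)
    ultimately show "x \<otimes>\<^bsub>add_monoid B\<^esub> z \<otimes>\<^bsub>add_monoid B\<^esub> inv\<^bsub>add_monoid B\<^esub> x \<in> socle B"
      by (simp add: a_inv_def)
  qed
  have "lam B b ` socle B = socle B" if b: "b \<in> carrier B" for b
  proof
    show "lam B b ` socle B \<subseteq> socle B" using socle_conj b by auto
    show "socle B \<subseteq> lam B b ` socle B"
    proof
      fix z assume z: "z \<in> socle B"
      then have "z = lam B b (lam B (inv b) z)"
        using b sub by (auto simp: lam_mult[symmetric] lam_one)
      then show "z \<in> lam B b ` socle B" using socle_conj(2)[OF z, of "inv b"] b by blast
    qed
  qed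
  then show ?thesis using nM nA by (simp add: skew_brace_ideal_def strong_left_ideal_def)
qed

lemma quot_socle_skew_brace: "skew_brace (B Quot socle B)"
  by (rule quot_skew_brace) (rule socle_ideal)

end

end

theory Submission
  imports Defs
begin

text \<open>
  The maps \<open>\<theta>\<^bsub>(a,b)\<^esub>\<close> are automorphisms of \<open>(B, +)\<close> and are closed under composition. The
  subgroup of \<open>(B, +)\<close> generated by a class \<open>[x]\<^sub>\<theta>\<close> is therefore a strong left ideal, and any
  strong left ideal containing \<open>x\<close> contains \<open>[x]\<^sub>\<theta>\<close>.

  If all classes are finite, this gives the finitely generated strong left ideals. For the
  quotient by the socle, it then suffices by Dietzmann's lemma (\<open>finite_generate_torsion\<close>) that
  every \<open>x\<close> has a positive multiple in the socle (\<open>some_multiple_in_socle\<close>). By the pigeonhole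
  principle some multiple \<open>c = kx\<close> satisfies \<open>\<lambda>\<^sub>c c = c\<close>. For such an element additive multiples
  are multiplicative powers, so that finite order of \<open>\<lambda>\<^sub>c\<close> yields a multiple \<open>nc\<close> in the kernel
  of \<open>\<lambda>\<close>. A further multiple is additively central, since additive conjugacy classes are finite.

  Conversely, if the quotient by the socle is covered by finite strong left ideals, then some
  power of each \<open>b\<close> lies in the socle, so that \<open>\<lambda>\<^sub>b\<close> has finite order. Let \<open>L\<close> be a strong left
  ideal that contains \<open>x\<close> and is finitely generated as a skew brace, and let \<open>A\<close> be the
  intersection of \<open>L\<close> with the socle. The generators of \<open>L\<close> lie in one finite strong left ideal
  modulo the socle, so \<open>L / A\<close> is finite, and a Schreier-type argument shows that the abelian
  group \<open>A\<close> is finitely generated (\<open>finitely_generated_socle_part\<close>). The classes of elements of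
  \<open>A\<close> are orbits under a group of torsion automorphisms of \<open>A\<close>. These orbits are finite by an
  argument of Minkowski: an automorphism of finite order that is the identity modulo 4 moves
  every element by a torsion element only (\<open>hom_congruent_id_mod_4\<close>,
  \<open>finite_orbit_of_torsion_automorphisms\<close>). Finally some multiple \<open>kx\<close> lies in \<open>A\<close>; an element
  \<open>y\<close> of \<open>[x]\<^sub>\<theta>\<close> is determined, up to the finite torsion subgroup of \<open>A\<close>, by its coset modulo
  \<open>A\<close> and by \<open>ky\<close>, which runs through the finite class of \<open>kx\<close>.
\<close>

section \<open>Finite conjugacy classes and torsion in groups\<close>

lemma nat_pigeonhole:
  fixes f :: "nat \<Rightarrow> 'b"
  assumes "finite A" "\<And>i. f i \<in> A"
  obtains i j where "i < j" "f i = f j"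
proof -
  have "\<not> inj f"
    using assms finite_subset[of "range f" A] finite_imageD[of f UNIV] by auto
  then obtain i j where "i \<noteq> j" "f i = f j" by (auto simp: inj_def)
  then show ?thesis using that[of i j] that[of j i] by (cases "i < j") auto
qed

lemma common_multiple:
  fixes P :: "'b \<Rightarrow> nat \<Rightarrow> bool"
  assumes "finite T" and ex: "\<And>t. t \<in> T \<Longrightarrow> \<exists>n>0. P t n"
    and mult: "\<And>t n k. t \<in> T \<Longrightarrow> P t n \<Longrightarrow> P t (n * k)"
  shows "\<exists>n>0. \<forall>t\<in>T. P t n"
  using assms
proof (induction T rule: finite_induct)
  case (insert t T)
  then obtain m n where mn: "m > 0" "\<forall>s\<in>T. P s m" "n > 0" "P t n" by (metis insertCI)
  then show ?case
    using insert.prems(2)[of _ m n] insert.prems(2)[of t n m]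
    by (intro exI[of _ "m * n"]) (auto simp: mult.commute)
qed auto

context group
begin

lemma commute_conj_iff:
  assumes "x \<in> carrier G" "g \<in> carrier G"
  shows "g \<otimes> x \<otimes> inv g = x \<longleftrightarrow> g \<otimes> x = x \<otimes> g"
  using assms by (metis inv_solve_right' m_closed inv_closed)

text \<open>Two of the conjugates of \<open>t\<close> by powers of \<open>x\<close> coincide.\<close>
lemma some_power_commutes:
  assumes x: "x \<in> carrier G" and t: "t \<in> carrier G"
    and fin: "finite {g \<otimes> t \<otimes> inv g | g. g \<in> carrier G}"
  obtains n :: nat where "n > 0" "x [^] n \<otimes> t = t \<otimes> x [^] n"
proof -
  obtain i j :: nat where ij: "i < j"
      and eq: "x [^] i \<otimes> t \<otimes> inv (x [^] i) = x [^] j \<otimes> t \<otimes> inv (x [^] j)"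
    by (rule nat_pigeonhole[OF fin, of "\<lambda>i. x [^] i \<otimes> t \<otimes> inv (x [^] i)"]) (use x in auto)
  define n where "n = j - i"
  have j: "x [^] j = x [^] i \<otimes> x [^] n"
    using ij x by (simp add: n_def nat_pow_mult)
  have "x [^] i \<otimes> t \<otimes> inv (x [^] i) = x [^] i \<otimes> (x [^] n \<otimes> t \<otimes> inv (x [^] n)) \<otimes> inv (x [^] i)"
    using eq x t by (simp add: j inv_mult_group m_assoc)
  then have "x [^] n \<otimes> t \<otimes> inv (x [^] n) = t"
    using x t by (metis inv_closed l_cancel m_closed nat_pow_closed r_cancel)
  then have "x [^] n \<otimes> t = t \<otimes> x [^] n"
    using x t by (simp add: commute_conj_iff)
  then show ?thesis using that[of n] ij by (simp add: n_def)
qed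

text \<open>
  If \<open>T\<close> is a finite set such that every conjugate of \<open>x\<close> is \<open>t x t\<^sup>-\<^sup>1\<close> for some \<open>t \<in> T\<close>, then
  the group is \<open>T\<close> times the centraliser of \<open>x\<close>. Hence a power of \<open>x\<close> that commutes with the
  finitely many elements of \<open>T\<close> is central.
\<close>
lemma some_power_central:
  assumes x: "x \<in> carrier G"
    and fin: "\<And>t. t \<in> carrier G \<Longrightarrow> finite {g \<otimes> t \<otimes> inv g | g. g \<in> carrier G}"
  obtains n :: nat where "n > 0" "\<And>g. g \<in> carrier G \<Longrightarrow> x [^] n \<otimes> g = g \<otimes> x [^] n"
proof -
  have "(\<lambda>g. g \<otimes> x \<otimes> inv g) ` carrier G = {g \<otimes> x \<otimes> inv g | g. g \<in> carrier G}" by auto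
  then obtain T where T: "T \<subseteq> carrier G" "finite T"
      "(\<lambda>g. g \<otimes> x \<otimes> inv g) ` carrier G = (\<lambda>g. g \<otimes> x \<otimes> inv g) ` T"
    using fin[OF x] finite_subset_image[of "(\<lambda>g. g \<otimes> x \<otimes> inv g) ` carrier G" "\<lambda>g. g \<otimes> x \<otimes> inv g" "carrier G"]
    by auto
  have "\<exists>n::nat>0. \<forall>t\<in>T. x [^] n \<otimes> t = t \<otimes> x [^] n"
  proof (rule common_multiple[OF \<open>finite T\<close>])
    fix t assume "t \<in> T"
    then have t: "t \<in> carrier G" using T by auto
    show "\<exists>n>0::nat. x [^] n \<otimes> t = t \<otimes> x [^] n"
      using some_power_commutes[OF x t fin[OF t]] by metis
  next
    fix t and n k :: nat assume "t \<in> T" "x [^] n \<otimes> t = t \<otimes> x [^] n"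
    then show "x [^] (n * k) \<otimes> t = t \<otimes> x [^] (n * k)"
      using x T group_commutes_pow[of "x [^] n" t k] by (auto simp: nat_pow_pow)
  qed
  then obtain n :: nat where n: "n > 0" "\<forall>t\<in>T. x [^] n \<otimes> t = t \<otimes> x [^] n" by auto
  have "x [^] n \<otimes> g = g \<otimes> x [^] n" if g: "g \<in> carrier G" for g
  proof -
    obtain t where t: "t \<in> T" "g \<otimes> x \<otimes> inv g = t \<otimes> x \<otimes> inv t"
      using T g by (metis (no_types, lifting) image_iff)
    have tc: "t \<in> carrier G" using t T by auto
    define c where "c = inv t \<otimes> g"
    have c: "c \<in> carrier G" "g = t \<otimes> c" using g tc by (auto simp: c_def m_assoc[symmetric])
    have "t \<otimes> (c \<otimes> x \<otimes> inv c) \<otimes> inv t = t \<otimes> x \<otimes> inv t"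
      using t(2) c x tc by (simp add: inv_mult_group m_assoc)
    then have "c \<otimes> x \<otimes> inv c = x"
      using c(1) x tc by (metis inv_closed l_cancel m_closed r_cancel)
    then have "x \<otimes> c = c \<otimes> x" using c x by (simp add: commute_conj_iff)
    then have xc: "x [^] n \<otimes> c = c \<otimes> x [^] n" using c x by (simp add: group_commutes_pow)
    have "x [^] n \<otimes> g = (x [^] n \<otimes> t) \<otimes> c" using c x tc by (simp add: m_assoc)
    also have "\<dots> = t \<otimes> (x [^] n \<otimes> c)" using n t c x tc by (simp add: m_assoc)
    also have "\<dots> = g \<otimes> x [^] n" using xc c x tc by (simp add: m_assoc)
    finally show ?thesis .
  qed
  then show ?thesis using that n by blast
qed

definition word :: "'a list \<Rightarrow> 'a" where
  "word w = foldr (\<otimes>) w \<one>"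

lemma word_simps [simp]: "word [] = \<one>" "word (x # w) = x \<otimes> word w"
  by (auto simp: word_def)

lemma word_closed [simp]: "set w \<subseteq> carrier G \<Longrightarrow> word w \<in> carrier G"
  by (induction w) auto

lemma word_append [simp]:
  "set u \<subseteq> carrier G \<Longrightarrow> set v \<subseteq> carrier G \<Longrightarrow> word (u @ v) = word u \<otimes> word v"
  by (induction u) (auto simp: m_assoc)

lemma word_conj:
  "set u \<subseteq> carrier G \<Longrightarrow> x \<in> carrier G \<Longrightarrow> x \<otimes> word (map (\<lambda>y. inv x \<otimes> y \<otimes> x) u) = word u \<otimes> x"
proof (induction u)
  case (Cons y u)
  let ?u = "word (map (\<lambda>y. inv x \<otimes> y \<otimes> x) u)"
  have c: "?u \<in> carrier G" "x \<in> carrier G" "y \<in> carrier G" using Cons.prems by (auto intro!: word_closed simp: subset_iff)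
  have "x \<otimes> word (map (\<lambda>y. inv x \<otimes> y \<otimes> x) (y # u)) =
      x \<otimes> (inv x \<otimes> y \<otimes> x \<otimes> word (map (\<lambda>y. inv x \<otimes> y \<otimes> x) u))"
    by simp
  also have "\<dots> = y \<otimes> (x \<otimes> word (map (\<lambda>y. inv x \<otimes> y \<otimes> x) u))"
    using c by (simp add: m_assoc[symmetric])
  also have "\<dots> = word (y # u) \<otimes> x"
    using Cons by (simp add: m_assoc)
  finally show ?case .
qed auto

text \<open>
  Moving an occurrence of \<open>x\<close> to the front conjugates the letters that it passes by \<open>x\<close>. They
  stay in \<open>S\<close>, and those equal to \<open>x\<close> do not change, so that the move can be repeated.
\<close>
lemma word_collect:
  assumes S: "S \<subseteq> carrier G" and conj: "\<And>x y. x \<in> S \<Longrightarrow> y \<in> S \<Longrightarrow> inv x \<otimes> y \<otimes> x \<in> S"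
    and x: "x \<in> S" and w: "set w \<subseteq> S" and count: "n \<le> count_list w x"
  shows "\<exists>v. set v \<subseteq> S \<and> length v + n = length w \<and> word w = x [^] n \<otimes> word v
    \<and> count_list v x + n = count_list w x"
  using count
proof (induction n)
  case 0
  then show ?case using w S by (intro exI[of _ w]) auto
next
  case (Suc n)
  then obtain v where v: "set v \<subseteq> S" "length v + n = length w" "word w = x [^] n \<otimes> word v"
      "count_list v x + n = count_list w x" by auto
  then have "x \<in> set v" using Suc.prems count_notin[of x v] by fastforce
  then obtain a b where ab: "v = a @ x # b" by (meson split_list)
  have xc: "x \<in> carrier G" and ac: "set a \<subseteq> carrier G" and bc: "set b \<subseteq> carrier G"
    using x S v ab by auto
  define a' where "a' = map (\<lambda>y. inv x \<otimes> y \<otimes> x) a"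
  have a'S: "set a' \<subseteq> S" using v x conj ab by (auto simp: a'_def)
  then have a'c: "set a' \<subseteq> carrier G" using S by auto
  have iff: "inv x \<otimes> y \<otimes> x = x \<longleftrightarrow> y = x" if "y \<in> carrier G" for y
    using that xc by (metis inv_closed l_inv r_one m_closed r_cancel l_cancel l_one m_assoc)
  have "count_list a' x = count_list a x"
    using ac unfolding a'_def by (induction a) (auto simp: iff)
  moreover have "word v = x \<otimes> word (a' @ b)"
  proof -
    have "word v = (word a \<otimes> x) \<otimes> word b" using ab ac bc xc by (simp add: m_assoc)
    also have "\<dots> = x \<otimes> word a' \<otimes> word b" using word_conj[OF ac xc] by (simp add: a'_def)
    finally show ?thesis using a'c bc xc by (simp add: m_assoc)
  qed
  ultimately show ?case
    using v ab a'S a'c bc xc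
    by (intro exI[of _ "a' @ b"]) (auto simp: a'_def m_assoc)
qed

text \<open>
  Dietzmann's lemma. A long word in \<open>S\<close> contains some letter \<open>x\<close> at least \<open>N\<close> times, where \<open>N\<close>
  is a common exponent of the elements of \<open>S\<close>; collecting \<open>N\<close> of these occurrences at the front
  gives a shorter word with the same value. So short words suffice.
\<close>
lemma finite_generate_torsion:
  assumes fin: "finite S" and S: "S \<subseteq> carrier G"
    and conj: "\<And>x y. x \<in> S \<Longrightarrow> y \<in> S \<Longrightarrow> inv x \<otimes> y \<otimes> x \<in> S"
    and tor: "\<And>x. x \<in> S \<Longrightarrow> \<exists>n::nat>0. x [^] n = \<one>"
  shows "finite (generate G S)"
proof -
  have "\<exists>n::nat>0. \<forall>x\<in>S. x [^] n = \<one>"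
  proof (rule common_multiple[OF fin tor])
    fix t and n k :: nat assume "t \<in> S" "t [^] n = \<one>"
    then show "t [^] (n * k) = \<one>" using S nat_pow_pow[of t n k] by auto
  qed
  then obtain N :: nat where N: "N > 0" "\<And>x. x \<in> S \<Longrightarrow> x [^] N = \<one>" by auto
  define K where "K = card S * N"
  define W where "W = word ` {w. set w \<subseteq> S \<and> length w \<le> K}"
  have short: "word w \<in> W" if "set w \<subseteq> S" for w
    using that
  proof (induction w rule: length_induct)
    case (1 w)
    show ?case
    proof (cases "length w \<le> K")
      case True
      then show ?thesis using 1 by (auto simp: W_def)
    next
      case False
      have "\<exists>x\<in>S. N \<le> count_list w x"
      proof (rule ccontr)
        assume "\<not> ?thesis"
        then have "sum (count_list w) S \<le> card S * N"
          using sum_bounded_above[of S "count_list w" N] by force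
        moreover have "sum (count_list w) S = length w"
          using sum_count_set[of w S] 1 fin by simp
        ultimately show False using False by (simp add: K_def)
      qed
      then obtain x where x: "x \<in> S" "N \<le> count_list w x" by auto
      obtain v where v: "set v \<subseteq> S" "length v + N = length w" "word w = x [^] N \<otimes> word v"
        using word_collect[OF S conj x(1) 1(2) x(2)] by auto
      have "word v \<in> W" using 1 v N by auto
      moreover have "set v \<subseteq> carrier G" using v S by auto
      ultimately show ?thesis using v N x by simp
    qed
  qed
  have "\<exists>w. set w \<subseteq> S \<and> g = word w" if "g \<in> generate G S" for g
    using that
  proof (induction rule: generate.induct)
    case one
    show ?case by (intro exI[of _ "[]"]) auto
  next
    case (incl h)
    then show ?case using S by (intro exI[of _ "[h]"]) auto
  next
    case (inv h)
    then have h: "h \<in> carrier G" using S by auto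
    have w: "word (replicate n h) = h [^] n" for n
      using h by (induction n) (simp_all flip: nat_pow_Suc2)
    have "h [^] (N - 1) \<otimes> h = \<one>" using N inv by (simp flip: nat_pow_Suc)
    then have "inv h = word (replicate (N - 1) h)"
      using h w by (simp add: inv_equality)
    then show ?case using inv by (intro exI[of _ "replicate (N - 1) h"]) auto
  next
    case (eng h1 h2)
    then obtain u v where uv: "set u \<subseteq> S" "h1 = word u" "set v \<subseteq> S" "h2 = word v" by auto
    then show ?case using S by (intro exI[of _ "u @ v"]) (auto simp: subset_trans[OF _ S])
  qed
  then have "generate G S \<subseteq> W" using short by auto
  moreover have "finite W" unfolding W_def using finite_lists_length_le[OF fin] by auto
  ultimately show ?thesis by (rule finite_subset)
qed

end

section \<open>Torsion automorphisms of finitely generated abelian groups\<close>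

lemma (in group) hom_funpow: "f \<in> hom G G \<Longrightarrow> f ^^ n \<in> hom G G"
  by (induction n) (auto simp: hom_def Pi_iff)

context comm_group
begin

lemma generate_insert:
  assumes S: "insert x S \<subseteq> carrier G" and g: "g \<in> generate G (insert x S)"
  obtains c :: int and h where "h \<in> generate G S" "g = x [^] c \<otimes> h"
proof -
  have x: "x \<in> carrier G" and Sc: "S \<subseteq> carrier G" using S by auto
  note gc = generate_in_carrier[OF Sc]
  have "\<exists>c::int. \<exists>h\<in>generate G S. g = x [^] c \<otimes> h"
    using g
  proof (induction rule: generate.induct)
    case one
    show ?case by (intro exI[of _ 0] bexI[of _ \<one>]) (auto intro: generate.one)
  next
    case (incl h)
    show ?case
    proof (cases "h \<in> S")
      case True
      then show ?thesis using Sc by (intro exI[of _ 0] bexI[of _ h]) (auto intro: generate.incl)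
    next
      case False
      then show ?thesis
        using incl x by (intro exI[of _ 1] bexI[of _ \<one>]) (auto intro: generate.one)
    qed
  next
    case (inv h)
    show ?case
    proof (cases "h \<in> S")
      case True
      then show ?thesis using Sc by (intro exI[of _ 0] bexI[of _ "inv h"]) (auto intro: generate.inv)
    next
      case False
      then show ?thesis
        using inv x by (intro exI[of _ "-1"] bexI[of _ \<one>]) (auto intro: generate.one simp: int_pow_neg)
    qed
  next
    case (eng g1 g2)
    then obtain c d :: int and h k where
        h: "h \<in> generate G S" "g1 = x [^] c \<otimes> h" "k \<in> generate G S" "g2 = x [^] d \<otimes> k"
      by auto
    have "g1 \<otimes> g2 = x [^] (c + d) \<otimes> (h \<otimes> k)"
      using h gc x by (simp add: int_pow_mult m_ac)
    then show ?case using h by (auto intro: generate.eng)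
  qed
  then show ?thesis using that by auto
qed

lemma generate_int_pow:
  assumes "S \<subseteq> carrier G" "g \<in> generate G S"
  shows "g [^] (n::int) \<in> generate G S"
  using assms subgroup_int_pow_closed generate_is_subgroup by blast

lemma generate_killed:
  assumes S: "S \<subseteq> carrier G" and "\<And>x. x \<in> S \<Longrightarrow> x [^] (n::int) = \<one>" and "g \<in> generate G S"
  shows "g [^] n = \<one>"
  using assms(3)
proof (induction rule: generate.induct)
  case (eng h1 h2)
  then show ?case using generate_in_carrier[OF S] by (simp add: int_pow_distrib)
qed (use assms in \<open>auto simp: int_pow_inv subset_iff\<close>)

text \<open>
  Nakayama's lemma at the prime 2. Each step solves the relation for one generator \<open>x\<close> for an
  odd power of \<open>x\<close> in terms of the other generators, and substitutes this into their relations.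
\<close>
lemma odd_exponent_of_square_relations:
  assumes "finite S" "S \<subseteq> carrier G"
    and "\<And>x. x \<in> S \<Longrightarrow> \<exists>u::int. odd u \<and> (\<exists>h\<in>generate G S. x [^] u = h [^] (2::int))"
  shows "\<exists>m::int. odd m \<and> (\<forall>x\<in>S. x [^] m = \<one>)"
  using assms
proof (induction S rule: finite_induct)
  case empty
  show ?case by (intro exI[of _ 1]) auto
next
  case (insert x F)
  have x: "x \<in> carrier G" and F: "F \<subseteq> carrier G" using insert.prems by auto
  note gc = generate_in_carrier[OF F]
  obtain u :: int and h' where u: "odd u" and h': "h' \<in> generate G (insert x F)" "x [^] u = h' [^] (2::int)"
    using insert.prems(2)[of x] by auto
  obtain c :: int and h where h: "h \<in> generate G F" "h' = x [^] c \<otimes> h"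
    using generate_insert[OF insert.prems(1) h'(1)] by blast
  define v where "v = u - 2 * c"
  have "odd v" using u by (simp add: v_def)
  have hc: "h \<in> carrier G" using gc h by auto
  have "x [^] v = x [^] u \<otimes> inv (x [^] (2 * c))" using x by (simp add: v_def int_pow_diff)
  also have "\<dots> = x [^] (2 * c) \<otimes> h [^] (2::int) \<otimes> inv (x [^] (2 * c))"
    using h h' x hc by (simp add: int_pow_distrib int_pow_pow mult.commute)
  also have "\<dots> = h [^] (2::int)"
    using hc x by (simp add: m_ac)
  finally have xv: "x [^] v = h [^] (2::int)" .
  have "\<exists>u::int. odd u \<and> (\<exists>h\<in>generate G F. y [^] u = h [^] (2::int))" if y: "y \<in> F" for y
  proof -
    obtain w :: int and k' where w: "odd w" and k': "k' \<in> generate G (insert x F)" "y [^] w = k' [^] (2::int)"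
      using insert.prems(2)[of y] y by auto
    obtain d :: int and k where k: "k \<in> generate G F" "k' = x [^] d \<otimes> k"
      using generate_insert[OF insert.prems(1) k'(1)] by blast
    have kc: "k \<in> carrier G" and yc: "y \<in> carrier G" using gc k y F by auto
    have "y [^] (w * v) = (y [^] w) [^] v" using yc by (simp add: int_pow_pow)
    also have "\<dots> = (x [^] v) [^] (2 * d) \<otimes> (k [^] v) [^] (2::int)"
      using k k' x kc by (simp add: int_pow_distrib int_pow_pow mult.commute mult.left_commute)
    also have "\<dots> = (h [^] (2 * d) \<otimes> k [^] v) [^] (2::int)"
      using hc kc by (simp add: xv int_pow_distrib int_pow_pow mult.commute mult.left_commute)
    finally have "y [^] (w * v) = (h [^] (2 * d) \<otimes> k [^] v) [^] (2::int)" .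
    moreover have "odd (w * v)" using w \<open>odd v\<close> by simp
    moreover have "h [^] (2 * d) \<otimes> k [^] v \<in> generate G F"
      using generate_int_pow[OF F] h k by (blast intro: generate.eng)
    ultimately show ?thesis by blast
  qed
  then obtain m :: int where m: "odd m" "\<forall>y\<in>F. y [^] m = \<one>"
    using insert.IH F by auto
  have "h [^] m = \<one>" using generate_killed[OF F _ h(1)] m by auto
  have "x [^] (v * m) = (x [^] v) [^] m" using x by (simp add: int_pow_pow)
  also have "\<dots> = (h [^] m) [^] (2::int)" using hc by (simp add: xv int_pow_pow mult.commute)
  finally have "x [^] (v * m) = \<one>" using \<open>h [^] m = \<one>\<close> by simp
  moreover have "y [^] (v * m) = \<one>" if "y \<in> F" for y
    using m that F int_pow_pow[of y m v] by (auto simp: mult.commute)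
  ultimately show ?case using m \<open>odd v\<close> by (intro exI[of _ "v * m"]) auto
qed

text \<open>
  A version for finitely generated abelian groups of Minkowski's theorem that the kernel of
  \<open>GL\<^sub>n(\<int>) \<rightarrow> GL\<^sub>n(\<int>/4)\<close> is torsion-free. Write the group additively and let \<open>g = k(f - 1)\<close>.
  Since \<open>f\<close> is the identity modulo 4, the element \<open>k(f\<^sup>n - 1)a - n g(a)\<close> is 4 times an element
  of the image of \<open>g\<close>. If \<open>n\<close> is odd, this makes the image of \<open>g\<close> equal to its double, so that
  Nakayama's lemma applies; if \<open>n = 2\<close>, the same holds for the image of \<open>2g\<close>. An even \<open>n\<close> is
  reduced to this case by induction, applied to \<open>f\<^sup>2\<close>; the induction only shows that \<open>f\<^sup>2 - 1\<close>
  is killed by some integer, which is why the hypothesis contains the factor \<open>k\<close>.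
\<close>
lemma hom_congruent_id_mod_4:
  assumes fin: "finite S" and S: "S \<subseteq> carrier G" and gen: "generate G S = carrier G"
    and "f \<in> hom G G"
    and "\<And>a. a \<in> carrier G \<Longrightarrow> \<exists>b\<in>carrier G. f a = a \<otimes> b [^] (4::int)"
    and "n > 0" "k \<noteq> 0"
    and "\<And>a. a \<in> carrier G \<Longrightarrow> ((f ^^ n) a \<otimes> inv a) [^] (k::int) = \<one>"
  shows "\<exists>m::int. m \<noteq> 0 \<and> (\<forall>a\<in>carrier G. (f a \<otimes> inv a) [^] m = \<one>)"
  using assms(4-)
proof (induction n arbitrary: f k rule: less_induct)
  case (less n f k)
  note f = less.prems(1) and f4 = less.prems(2)
  have fc: "f a \<in> carrier G" if "a \<in> carrier G" for a using f that by (auto simp: hom_def)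
  have fm: "f (a \<otimes> b) = f a \<otimes> f b" if "a \<in> carrier G" "b \<in> carrier G" for a b
    using f that by (auto simp: hom_def)
  have pc: "(f ^^ i) a \<in> carrier G" if "a \<in> carrier G" for a i
    using hom_funpow[OF f] that by (auto simp: hom_def)
  have pow4: "\<exists>b\<in>carrier G. (f ^^ i) a = a \<otimes> b [^] (4::int)" if a: "a \<in> carrier G" for a i
  proof (induction i)
    case 0
    show ?case using a by (intro bexI[of _ \<one>]) auto
  next
    case (Suc i)
    then obtain b where b: "b \<in> carrier G" "(f ^^ i) a = a \<otimes> b [^] (4::int)" by auto
    obtain c where c: "c \<in> carrier G" "f ((f ^^ i) a) = (f ^^ i) a \<otimes> c [^] (4::int)"
      using f4[OF pc[OF a]] by auto
    have "(f ^^ Suc i) a = a \<otimes> (b \<otimes> c) [^] (4::int)"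
      using a b c by (simp add: int_pow_distrib m_ac)
    then show ?case using b c by blast
  qed
  have closing: ?case
    if ghom: "g \<in> hom G G" and g: "\<And>a. a \<in> carrier G \<Longrightarrow> g a = (f a \<otimes> inv a) [^] (l::int)"
      and l: "l \<noteq> 0" and u: "odd (u::int)"
      and rel: "\<And>a. a \<in> carrier G \<Longrightarrow> \<exists>b\<in>carrier G. g a [^] u = g b [^] (2::int)" for g l u
  proof -
    interpret g: group_hom G G g by unfold_locales (rule ghom)
    have img: "generate G (g ` S) = g ` carrier G" using g.generate_img[OF S] gen by simp
    have gS: "g ` S \<subseteq> carrier G" using S by auto
    have "\<exists>m::int. odd m \<and> (\<forall>x\<in>g ` S. x [^] m = \<one>)"
    proof (rule odd_exponent_of_square_relations)
      fix y assume "y \<in> g ` S"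
      then obtain x where x: "x \<in> carrier G" "y = g x" using S by auto
      then show "\<exists>u::int. odd u \<and> (\<exists>h\<in>generate G (g ` S). y [^] u = h [^] (2::int))"
        using rel[OF x(1)] u by (auto simp: img)
    qed (use fin gS in auto)
    then obtain m :: int where m: "odd m" "\<forall>x\<in>g ` S. x [^] m = \<one>" by auto
    have "(f a \<otimes> inv a) [^] (l * m) = \<one>" if a: "a \<in> carrier G" for a
    proof -
      have "g a [^] m = \<one>" using generate_killed[OF gS, of m "g a"] m(2) a img by auto
      then show ?thesis using a fc by (simp add: g int_pow_pow)
    qed
    moreover have "l * m \<noteq> 0" using l m(1) by auto
    ultimately show ?thesis by blast
  qed
  have ghom: "(\<lambda>a. (f a \<otimes> inv a) [^] (l::int)) \<in> hom G G" for l
    using fc by (intro homI) (auto simp: fm inv_mult int_pow_distrib m_ac)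
  have expand: "\<exists>b\<in>carrier G. ((f ^^ i) a \<otimes> inv a) [^] l = g a [^] (int i) \<otimes> g b [^] (4::int)"
    if g_def: "g = (\<lambda>a. (f a \<otimes> inv a) [^] (l::int))" and a: "a \<in> carrier G" for g l a i
  proof -
    interpret g: group_hom G G g by unfold_locales (auto simp: g_def ghom)
    show ?thesis
    proof (induction i)
      case 0
      show ?case using a by (intro bexI[of _ \<one>]) auto
    next
      case (Suc i)
      then obtain b where b: "b \<in> carrier G"
          "((f ^^ i) a \<otimes> inv a) [^] l = g a [^] (int i) \<otimes> g b [^] (4::int)" by auto
      obtain c where c: "c \<in> carrier G" "(f ^^ i) a = a \<otimes> c [^] (4::int)" using pow4[OF a] by auto
      have "g ((f ^^ i) a) = g a \<otimes> g c [^] (4::int)"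
        using a c by (simp add: g.hom_int_pow)
      moreover have "((f ^^ Suc i) a \<otimes> inv a) [^] l = g ((f ^^ i) a) \<otimes> ((f ^^ i) a \<otimes> inv a) [^] l"
      proof -
        have "(f ^^ Suc i) a \<otimes> inv a =
            (f ((f ^^ i) a) \<otimes> inv ((f ^^ i) a)) \<otimes> ((f ^^ i) a \<otimes> inv a)"
          using a pc[OF a, of i] fc[OF pc[OF a, of i]] by (simp add: m_assoc) (simp add: m_assoc[symmetric])
        then show ?thesis
          using a pc[OF a, of i] fc[OF pc[OF a, of i]] by (simp add: g_def int_pow_distrib)
      qed
      ultimately have "((f ^^ Suc i) a \<otimes> inv a) [^] l =
          (g a \<otimes> g c [^] (4::int)) \<otimes> (g a [^] (int i) \<otimes> g b [^] (4::int))"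
        using b(2) by metis
      then have "((f ^^ Suc i) a \<otimes> inv a) [^] l = g a [^] int (Suc i) \<otimes> g (b \<otimes> c) [^] (4::int)"
        using a b c by (simp add: int_pow_distrib int_pow_mult m_ac)
      then show ?case using b c by blast
    qed
  qed
  show ?case
  proof (cases "odd n")
    case True
    define g where "g = (\<lambda>a. (f a \<otimes> inv a) [^] k)"
    interpret g: group_hom G G g by unfold_locales (auto simp: g_def ghom)
    have "\<exists>b\<in>carrier G. g a [^] int n = g b [^] (2::int)" if a: "a \<in> carrier G" for a
    proof -
      obtain b where b: "b \<in> carrier G" "((f ^^ n) a \<otimes> inv a) [^] k = g a [^] (int n) \<otimes> g b [^] (4::int)"
        using expand[OF g_def a] by blast
      then have "g a [^] (int n) \<otimes> g b [^] (4::int) = \<one>" using less.prems(5) a by simp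
      then have "g a [^] int n = inv (g b [^] (4::int))"
        using a b by (metis g.hom_closed int_pow_closed inv_equality)
      also have "\<dots> = g (b [^] (-2::int)) [^] (2::int)"
        using b by (simp add: g.hom_int_pow int_pow_pow flip: int_pow_neg)
      finally show ?thesis using b by blast
    qed
    then show ?thesis
      using True less.prems(4) by (intro closing[of g k "int n"]) (auto simp: g_def ghom)
  next
    case False
    then obtain m where m: "n = 2 * m" "m > 0" "m < n" using less.prems(3) by (auto elim: evenE)
    have ff: "f ^^ n = (f ^^ 2) ^^ m" using m by (simp add: funpow_mult)
    obtain l :: int where l: "l \<noteq> 0" "\<forall>a\<in>carrier G. ((f ^^ 2) a \<otimes> inv a) [^] l = \<one>"
      using less.IH[OF m(3) hom_funpow[OF f] pow4 m(2) less.prems(4)] less.prems(5) ff by metis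
    define g where "g = (\<lambda>a. (f a \<otimes> inv a) [^] l)"
    interpret g: group_hom G G g by unfold_locales (auto simp: g_def ghom)
    define h where "h = (\<lambda>a. (f a \<otimes> inv a) [^] (l * 2))"
    have hg: "h a = g a [^] (2::int)" if "a \<in> carrier G" for a
      using that fc by (simp add: h_def g_def int_pow_pow)
    have "\<exists>b\<in>carrier G. h a [^] (1::int) = h b [^] (2::int)" if a: "a \<in> carrier G" for a
    proof -
      obtain b where b: "b \<in> carrier G" "((f ^^ 2) a \<otimes> inv a) [^] l = g a [^] (int 2) \<otimes> g b [^] (4::int)"
        using expand[OF g_def a] by blast
      then have "g a [^] (2::int) \<otimes> g b [^] (4::int) = \<one>" using l(2) a by simp
      then have "g a [^] (2::int) = inv (g b [^] (4::int))"
        using a b by (metis g.hom_closed int_pow_closed inv_equality)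
      also have "\<dots> = h (inv b) [^] (2::int)"
        using b by (simp add: hg int_pow_pow int_pow_inv)
      finally show ?thesis using a b hg fc
        by (intro bexI[of _ "inv b"]) (auto simp: h_def)
    qed
    then show ?thesis
      using l(1) by (intro closing[of h "l * 2" 1]) (auto simp: h_def ghom)
  qed
qed

text \<open>
  In the induction step, either a positive power of the new generator \<open>x\<close> lies in the subgroup
  generated by \<open>F\<close>, which then has finite index, or every torsion element already lies in that
  subgroup.
\<close>
lemma finite_torsion_of_finitely_generated:
  assumes "finite S" "S \<subseteq> carrier G"
  shows "finite {t \<in> generate G S. \<exists>n::int. n \<noteq> 0 \<and> t [^] n = \<one>}"
  using assms
proof (induction S rule: finite_induct)
  case empty
  show ?case by (rule finite_subset[of _ "{\<one>}"]) (auto simp: generate_empty)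
next
  case (insert x F)
  have x: "x \<in> carrier G" and F: "F \<subseteq> carrier G" using insert.prems by auto
  note gc = generate_in_carrier[OF F]
  have sg: "subgroup (generate G F) G" using generate_is_subgroup[OF F] .
  define T where "T = {t \<in> generate G F. \<exists>n::int. n \<noteq> 0 \<and> t [^] n = \<one>}"
  have "finite T" using insert.IH F by (simp add: T_def)
  define T' where "T' = {t \<in> generate G (insert x F). \<exists>n::int. n \<noteq> 0 \<and> t [^] n = \<one>}"
  have T'c: "T' \<subseteq> carrier G" unfolding T'_def using generate_in_carrier[OF insert.prems] by auto
  have div: "s \<otimes> inv t \<in> T" if s: "s \<in> T'" "t \<in> T'" and st: "s \<otimes> inv t \<in> generate G F" for s t
  proof -
    obtain m n :: int where mn: "m \<noteq> 0" "s [^] m = \<one>" "n \<noteq> 0" "t [^] n = \<one>"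
      using s by (auto simp: T'_def)
    have sc: "s \<in> carrier G" "t \<in> carrier G" using s T'c by auto
    then have "(s \<otimes> inv t) [^] (m * n) = (s [^] m) [^] n \<otimes> inv ((t [^] n) [^] m)"
      by (simp add: int_pow_distrib int_pow_inv int_pow_pow mult.commute)
    then have "(s \<otimes> inv t) [^] (m * n) = \<one>" using mn by simp
    moreover have "m * n \<noteq> 0" using mn by simp
    ultimately show ?thesis using st unfolding T_def by blast
  qed
  show ?case
  proof (cases "\<exists>j::int. j > 0 \<and> x [^] j \<in> generate G F")
    case True
    then obtain j :: int where j: "j > 0" "x [^] j \<in> generate G F" by auto
    have *: "\<exists>c\<in>{0..<j}. t \<otimes> inv (x [^] c) \<in> generate G F" if t: "t \<in> T'" for t
    proof -
      have "t \<in> generate G (insert x F)" using t by (simp add: T'_def)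
      then obtain c :: int and h where h: "h \<in> generate G F" "t = x [^] c \<otimes> h"
        using generate_insert[OF insert.prems] by blast
      have "x [^] c = x [^] (j * (c div j) + c mod j)" by simp
      also have "\<dots> = (x [^] j) [^] (c div j) \<otimes> x [^] (c mod j)"
        using x by (simp only: int_pow_mult int_pow_pow)
      finally have "t = ((x [^] j) [^] (c div j) \<otimes> h) \<otimes> x [^] (c mod j)"
        using x h gc by (simp add: m_ac)
      then have "t \<otimes> inv (x [^] (c mod j)) = (x [^] j) [^] (c div j) \<otimes> h"
        using x h gc by (simp add: m_assoc)
      also have "\<dots> \<in> generate G F" using h j generate_int_pow[OF F] by (blast intro: generate.eng)
      finally show ?thesis using j by (intro bexI[of _ "c mod j"]) auto
    qed
    \<comment> \<open>\<open>C c\<close> is the part of \<open>T'\<close> in one coset of \<open>generate G F\<close>; its elements differ by elements of \<open>T\<close>.\<close>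
    define C where "C = (\<lambda>c::int. {t \<in> T'. t \<otimes> inv (x [^] c) \<in> generate G F})"
    have "finite (C c)" for c
    proof (cases "C c = {}")
      case False
      then obtain t where t: "t \<in> C c" by auto
      have "C c \<subseteq> (\<lambda>s. s \<otimes> t) ` T"
      proof
        fix s assume s: "s \<in> C c"
        have sc: "s \<in> carrier G" "t \<in> carrier G" using s t T'c by (auto simp: C_def)
        have "(s \<otimes> inv (x [^] c)) \<otimes> inv (t \<otimes> inv (x [^] c)) \<in> generate G F"
          using s t subgroup.m_inv_closed[OF sg] by (auto simp: C_def intro: generate.eng)
        moreover have "(s \<otimes> inv (x [^] c)) \<otimes> inv (t \<otimes> inv (x [^] c)) = s \<otimes> inv t"
          using sc x by (simp add: inv_mult m_ac)
        ultimately have "s \<otimes> inv t \<in> T" using div s t by (simp add: C_def)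
        moreover have "s = (s \<otimes> inv t) \<otimes> t" using sc by (simp add: m_assoc)
        ultimately show "s \<in> (\<lambda>s. s \<otimes> t) ` T" by blast
      qed
      then show ?thesis using \<open>finite T\<close> by (blast intro: finite_subset)
    qed auto
    moreover have "T' \<subseteq> (\<Union>c\<in>{0..<j}. C c)" using * by (auto simp: C_def)
    ultimately show ?thesis unfolding T'_def[symmetric] by (meson finite_UN finite_atLeastLessThan_int finite_subset)
  next
    case False
    have "t \<in> T" if t: "t \<in> T'" for t
    proof -
      have "t \<in> generate G (insert x F)" using t by (simp add: T'_def)
      then obtain c :: int and h where h: "h \<in> generate G F" "t = x [^] c \<otimes> h"
        using generate_insert[OF insert.prems] by blast
      obtain n :: int where n: "n \<noteq> 0" "t [^] n = \<one>" using t by (auto simp: T'_def)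
      have hc: "h \<in> carrier G" using gc h by auto
      have "x [^] (c * n) \<otimes> h [^] n = \<one>"
        using n h hc x by (simp add: int_pow_distrib int_pow_pow)
      then have "x [^] (c * n) = h [^] (- n)"
        using x hc by (metis int_pow_closed int_pow_neg inv_equality)
      then have e: "x [^] (c * n) \<in> generate G F" using generate_int_pow[OF F h(1)] by simp
      then have "x [^] (- (c * n)) \<in> generate G F"
        using x subgroup.m_inv_closed[OF sg] by (simp add: int_pow_neg)
      then have "\<not> c * n > 0" "\<not> - (c * n) > 0" using e False by blast+
      then have "c = 0" using n by (metis linorder_less_linear mult_eq_0_iff neg_0_less_iff_less)
      then have "t = h" using h hc by simp
      then show "t \<in> T" using n h by (auto simp: T_def)
    qed
    then have "T' \<subseteq> T" by auto
    then show ?thesis using \<open>finite T\<close> unfolding T'_def[symmetric] by (rule finite_subset)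
  qed
qed

text \<open>
  Every element is congruent modulo fourth powers to a product of the generators with exponents
  between 0 and 3.
\<close>
lemma finite_representatives_mod_4:
  assumes "finite S" "S \<subseteq> carrier G"
  obtains R where "finite R" "R \<subseteq> carrier G"
    "\<And>g. g \<in> generate G S \<Longrightarrow> \<exists>r\<in>R. \<exists>b\<in>carrier G. g = r \<otimes> b [^] (4::int)"
proof -
  have "\<exists>R. finite R \<and> R \<subseteq> carrier G \<and>
      (\<forall>g\<in>generate G S. \<exists>r\<in>R. \<exists>b\<in>carrier G. g = r \<otimes> b [^] (4::int))"
    using assms
  proof (induction S rule: finite_induct)
    case empty
    show ?case by (intro exI[of _ "{\<one>}"]) (auto simp: generate_empty intro!: bexI[of _ \<one>])
  next
    case (insert x F)
    have x: "x \<in> carrier G" using insert.prems by auto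
    obtain R where R: "finite R" "R \<subseteq> carrier G"
        "\<forall>g\<in>generate G F. \<exists>r\<in>R. \<exists>b\<in>carrier G. g = r \<otimes> b [^] (4::int)"
      using insert by auto
    define R' where "R' = (\<lambda>(c::int, r). x [^] c \<otimes> r) ` ({0..<4} \<times> R)"
    have "\<exists>r\<in>R'. \<exists>b\<in>carrier G. g = r \<otimes> b [^] (4::int)" if g: "g \<in> generate G (insert x F)" for g
    proof -
      obtain c :: int and h where h: "h \<in> generate G F" "g = x [^] c \<otimes> h"
        using generate_insert[OF insert.prems g] by blast
      obtain r b where rb: "r \<in> R" "b \<in> carrier G" "h = r \<otimes> b [^] (4::int)" using R h by blast
      have rc: "r \<in> carrier G" using rb R by auto
      have "x [^] c = x [^] (c mod 4 + (c div 4) * 4)" by simp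
      also have "\<dots> = x [^] (c mod 4) \<otimes> (x [^] (c div 4)) [^] (4::int)"
        using x by (simp only: int_pow_mult int_pow_pow)
      finally have "g = (x [^] (c mod 4) \<otimes> r) \<otimes> (x [^] (c div 4) \<otimes> b) [^] (4::int)"
        using x rb rc h by (simp add: int_pow_distrib m_ac)
      moreover have "x [^] (c mod 4) \<otimes> r \<in> R'" using rb by (force simp: R'_def)
      moreover have "x [^] (c div 4) \<otimes> b \<in> carrier G" using x rb by simp
      ultimately show ?thesis by blast
    qed
    moreover have "finite R'" "R' \<subseteq> carrier G" using R x by (auto simp: R'_def)
    ultimately show ?case by blast
  qed
  then show ?thesis using that by blast
qed

text \<open>
  Two elements of \<open>\<Phi>\<close> that agree modulo 4 on the generators differ by an automorphism that is
  the identity modulo 4, and such an automorphism moves \<open>s\<close> by an element of the finite torsion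
  subgroup.
\<close>
lemma finite_orbit_of_torsion_automorphisms:
  assumes fin: "finite S" and S: "S \<subseteq> carrier G" and gen: "generate G S = carrier G"
    and hom: "\<And>f. f \<in> \<Phi> \<Longrightarrow> f \<in> hom G G"
    and tor: "\<And>f. f \<in> \<Phi> \<Longrightarrow> \<exists>n>0. \<forall>a\<in>carrier G. (f ^^ n) a = a"
    and quot: "\<And>f g. f \<in> \<Phi> \<Longrightarrow> g \<in> \<Phi> \<Longrightarrow> \<exists>h\<in>\<Phi>. \<forall>a\<in>carrier G. g a = f (h a)"
    and s: "s \<in> carrier G"
  shows "finite ((\<lambda>f. f s) ` \<Phi>)"
proof -
  obtain R where R: "finite R" "R \<subseteq> carrier G"
      "\<And>g. g \<in> generate G S \<Longrightarrow> \<exists>r\<in>R. \<exists>b\<in>carrier G. g = r \<otimes> b [^] (4::int)"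
    using finite_representatives_mod_4[OF fin S] by blast
  define red where "red = (\<lambda>g. SOME r. r \<in> R \<and> (\<exists>b\<in>carrier G. g = r \<otimes> b [^] (4::int)))"
  have red: "red g \<in> R" "\<exists>b\<in>carrier G. g = red g \<otimes> b [^] (4::int)" if "g \<in> carrier G" for g
  proof -
    have "\<exists>r. r \<in> R \<and> (\<exists>b\<in>carrier G. g = r \<otimes> b [^] (4::int))" using R(3) that gen by blast
    from someI_ex[OF this] show "red g \<in> R" "\<exists>b\<in>carrier G. g = red g \<otimes> b [^] (4::int)"
      by (auto simp: red_def)
  qed
  define T where "T = {t \<in> carrier G. \<exists>n::int. n \<noteq> 0 \<and> t [^] n = \<one>}"
  have "finite T" using finite_torsion_of_finitely_generated[OF fin S] by (simp add: T_def gen)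
  have hc: "f a \<in> carrier G" if "f \<in> \<Phi>" "a \<in> carrier G" for f a
    using hom[OF that(1)] that(2) by (auto simp: hom_def)
  define key where "key = (\<lambda>f. restrict (\<lambda>x. red (f x)) S)"
  have "key ` \<Phi> \<subseteq> S \<rightarrow>\<^sub>E R"
    using red(1) hc S by (auto simp: key_def)
  then have fin_key: "finite (key ` \<Phi>)"
    using finite_PiE[OF fin, of "\<lambda>_. R"] R(1) finite_subset by blast
  have same: "\<exists>t\<in>T. g s = f s \<otimes> f t" if fg: "f \<in> \<Phi>" "g \<in> \<Phi>" and keq: "key f = key g" for f g
  proof -
    interpret f: group_hom G G f by unfold_locales (rule hom[OF fg(1)])
    obtain f' where f': "f' \<in> \<Phi>" "\<forall>a\<in>carrier G. f a = f (f' a)" using quot fg(1) by blast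
    obtain h where h: "h \<in> \<Phi>" "\<forall>a\<in>carrier G. g a = f (h a)" using quot fg by blast
    interpret h: group_hom G G h by unfold_locales (rule hom[OF h(1)])
    obtain n where n: "n > 0" "\<forall>a\<in>carrier G. (f ^^ n) a = a" using tor[OF fg(1)] by blast
    obtain i where i: "n = Suc i" using n(1) gr0_implies_Suc by blast
    have fi: "(f ^^ i) (f a) = a" if "a \<in> carrier G" for a
      using n(2) that by (simp add: i funpow_swap1)
    interpret fi: group_hom G G "f ^^ i"
      by unfold_locales (rule hom_funpow[OF hom[OF fg(1)]])
    have gen4: "\<exists>b\<in>carrier G. h x = x \<otimes> b [^] (4::int)" if x: "x \<in> S" for x
    proof -
      have xc: "x \<in> carrier G" using x S by auto
      have eq: "red (f x) = red (g x)" using fun_cong[OF keq, of x] x by (simp add: key_def)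
      obtain b c where b: "b \<in> carrier G" "f x = red (f x) \<otimes> b [^] (4::int)"
          and c: "c \<in> carrier G" "g x = red (f x) \<otimes> c [^] (4::int)"
        using red(2)[OF hc[OF fg(1) xc]] red(2)[OF hc[OF fg(2) xc]] eq by metis
      have rc: "red (f x) \<in> carrier G" using red(1)[OF hc[OF fg(1) xc]] R(2) by auto
      have "g x = f x \<otimes> (c \<otimes> inv b) [^] (4::int)"
        unfolding c(2) by (subst b(2)) (use b(1) c(1) rc in \<open>simp add: int_pow_distrib int_pow_inv m_ac\<close>)
      then have "(f ^^ i) (f (h x)) = (f ^^ i) (f x \<otimes> (c \<otimes> inv b) [^] (4::int))"
        using h(2) xc by simp
      also have "\<dots> = x \<otimes> (f ^^ i) (c \<otimes> inv b) [^] (4::int)"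
        using b(1) c(1) hc[OF fg(1) xc] fi[OF xc]
        by (metis fi.hom_mult fi.hom_int_pow int_pow_closed inv_closed m_closed)
      finally have "h x = x \<otimes> (f ^^ i) (c \<otimes> inv b) [^] (4::int)"
        using fi[OF h.hom_closed[OF xc]] by metis
      moreover have "(f ^^ i) (c \<otimes> inv b) \<in> carrier G" using b(1) c(1) by (intro fi.hom_closed) simp
      ultimately show ?thesis by blast
    qed
    have h4: "\<exists>b\<in>carrier G. h a = a \<otimes> b [^] (4::int)" if "a \<in> carrier G" for a
      using that unfolding gen[symmetric]
    proof (induction rule: generate.induct)
      case one
      show ?case by (rule bexI[of _ \<one>]) (auto simp: generate.one)
    next
      case (incl x)
      then show ?case using gen4 by (simp add: gen)
    next
      case (inv x)
      obtain b where b: "b \<in> carrier G" "h x = x \<otimes> b [^] (4::int)" using gen4[OF inv] by blast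
      have "h (inv x) = inv x \<otimes> (inv b) [^] (4::int)"
        using b inv S by (auto simp: inv_mult int_pow_inv)
      then show ?case using b by (auto simp: gen)
    next
      case (eng x y)
      then obtain b c where b: "b \<in> carrier G" "h x = x \<otimes> b [^] (4::int)"
          "c \<in> carrier G" "h y = y \<otimes> c [^] (4::int)" by (auto simp: gen)
      have "h (x \<otimes> y) = x \<otimes> y \<otimes> (b \<otimes> c) [^] (4::int)"
        using b eng by (simp add: gen int_pow_distrib m_ac)
      then show ?case using b by (metis gen m_closed)
    qed
    obtain N where N: "N > 0" "\<forall>a\<in>carrier G. (h ^^ N) a = a" using tor[OF h(1)] by blast
    obtain m :: int where m: "m \<noteq> 0" "\<forall>a\<in>carrier G. (h a \<otimes> inv a) [^] m = \<one>"
      using hom_congruent_id_mod_4[OF fin S gen hom[OF h(1)] h4 N(1), of 1] N(2) by auto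
    define t where "t = h s \<otimes> inv s"
    have "t \<in> T" using m s unfolding T_def t_def by auto
    moreover have "h s = s \<otimes> t" using s by (simp add: t_def m_lcomm[of s "h s"])
    then have "g s = f s \<otimes> f t"
      using h(2) s \<open>t \<in> T\<close> f.hom_mult[of s t] by (simp add: T_def)
    ultimately show ?thesis by blast
  qed
  define pick where "pick = inv_into \<Phi> key"
  have "(\<lambda>f. f s) ` \<Phi> \<subseteq> (\<Union>k\<in>key ` \<Phi>. (\<lambda>t. pick k s \<otimes> pick k t) ` T)"
  proof
    fix y assume "y \<in> (\<lambda>f. f s) ` \<Phi>"
    then obtain g where g: "g \<in> \<Phi>" "y = g s" by auto
    have "pick (key g) \<in> \<Phi>" "key (pick (key g)) = key g"
      using g by (auto simp: pick_def inv_into_into f_inv_into_f)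
    then have "y \<in> (\<lambda>t. pick (key g) s \<otimes> pick (key g) t) ` T"
      using same[OF _ g(1)] g(2) by (metis imageI)
    then show "y \<in> (\<Union>k\<in>key ` \<Phi>. (\<lambda>t. pick k s \<otimes> pick k t) ` T)"
      using g(1) by (intro UN_I[of "key g"]) auto
  qed
  moreover have "finite (\<Union>k\<in>key ` \<Phi>. (\<lambda>t. pick k s \<otimes> pick k t) ` T)"
    by (rule finite_UN_I[OF fin_key finite_imageI[OF \<open>finite T\<close>]])
  ultimately show ?thesis by (rule finite_subset)
qed

end

section \<open>The action of a skew brace on itself\<close>

context skew_brace
begin

lemma minus_minus_add: "x \<in> carrier B \<Longrightarrow> y \<in> carrier B \<Longrightarrow> \<ominus> (x \<oplus> y) = \<ominus> y \<oplus> \<ominus> x"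
  using add.inv_mult_group[of x y] by (simp add: a_inv_def)

lemma minus_minus: "x \<in> carrier B \<Longrightarrow> \<ominus> (\<ominus> x) = x"
  using add.inv_inv[of x] by (simp add: a_inv_def)

lemma lam_lam_inv: "a \<in> carrier B \<Longrightarrow> x \<in> carrier B \<Longrightarrow> lam B a (lam B (inv a) x) = x"
  by (simp add: lam_mult[symmetric] lam_one)

lemma lam_group_hom: "a \<in> carrier B \<Longrightarrow> group_hom (add_monoid B) (add_monoid B) (lam B a)"
  by unfold_locales (auto simp: hom_def lam_closed lam_add)

lemma lam_minus: "a \<in> carrier B \<Longrightarrow> x \<in> carrier B \<Longrightarrow> lam B a (\<ominus> x) = \<ominus> lam B a x"
  using group_hom.hom_inv[OF lam_group_hom, of a x] by (simp add: a_inv_def)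

abbreviation multiple :: "nat \<Rightarrow> 'a \<Rightarrow> 'a" where
  "multiple n x \<equiv> add_pow B n x"

lemma lam_add_pow:
  "a \<in> carrier B \<Longrightarrow> x \<in> carrier B \<Longrightarrow> lam B a (multiple n x) = multiple n (lam B a x)"
  using group_hom.hom_nat_pow[OF lam_group_hom, of a x n] by (simp add: add_pow_def)

lemma add_pow_closed: "x \<in> carrier B \<Longrightarrow> multiple n x \<in> carrier B"
  using add.nat_pow_closed[of x n] by (simp add: add_pow_def)

lemma add_pow_0: "multiple 0 x = \<zero>"
  and add_pow_Suc: "multiple (Suc n) x = multiple n x \<oplus> x"
  by (simp_all add: add_pow_def)

lemma inv_eq_minus_lam:
  assumes "a \<in> carrier B" shows "inv a = \<ominus> lam B (inv a) a"
proof -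
  have "inv a \<oplus> lam B (inv a) a = \<zero>"
    using assms mult_eq[of "inv a" a] by (simp add: one_eq_zero)
  then show ?thesis
    using assms add.inv_equality[of "inv a" "lam B (inv a) a"] by (simp add: a_inv_def lam_closed)
qed

lemma theta_eq: "theta B a b x = a \<oplus> lam B b x \<oplus> \<ominus> a"
  by (simp add: theta_def a_minus_def)

lemma theta_closed:
  "\<lbrakk>a \<in> carrier B; b \<in> carrier B; x \<in> carrier B\<rbrakk> \<Longrightarrow> theta B a b x \<in> carrier B"
  by (simp add: theta_eq a_simps lam_closed)

lemma theta_conj: "\<lbrakk>a \<in> carrier B; x \<in> carrier B\<rbrakk> \<Longrightarrow> theta B a \<one> x = a \<oplus> x \<oplus> \<ominus> a"
  by (simp add: theta_eq lam_one)

lemma theta_lam: "\<lbrakk>b \<in> carrier B; x \<in> carrier B\<rbrakk> \<Longrightarrow> theta B \<zero> b x = lam B b x"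
  using add.inv_one by (simp add: theta_eq lz rz lam_closed a_inv_def)

lemma theta_group_hom:
  assumes "a \<in> carrier B" "b \<in> carrier B"
  shows "group_hom (add_monoid B) (add_monoid B) (theta B a b)"
proof -
  have "theta B a b (x \<oplus> y) = theta B a b x \<oplus> theta B a b y" if "x \<in> carrier B" "y \<in> carrier B" for x y
    using assms that by (simp add: theta_eq lam_add lam_closed a_ass a_simps ln2)
  then show ?thesis
    using assms by unfold_locales (auto simp: hom_def theta_closed)
qed

lemma theta_add_pow:
  "\<lbrakk>a \<in> carrier B; b \<in> carrier B; x \<in> carrier B\<rbrakk> \<Longrightarrow> theta B a b (multiple n x) = multiple n (theta B a b x)"
  using group_hom.hom_nat_pow[OF theta_group_hom, of a b x n] by (simp add: add_pow_def)

lemma theta_theta: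
  assumes "a \<in> carrier B" "b \<in> carrier B" "c \<in> carrier B" "d \<in> carrier B" "x \<in> carrier B"
  shows "theta B a b (theta B c d x) = theta B (a \<oplus> lam B b c) (b \<otimes> d) x"
  using assms by (simp add: theta_eq lam_add lam_mult lam_minus lam_closed a_simps a_ass minus_minus_add)

lemma theta_class_self: "x \<in> carrier B \<Longrightarrow> x \<in> theta_class B x"
  using theta_lam[of \<one> x] lam_one[of x] z_closed one_closed
  unfolding theta_class_def mem_Collect_eq by (intro exI[of _ \<zero>] exI[of _ \<one>]) auto

lemma theta_class_subset: "x \<in> carrier B \<Longrightarrow> theta_class B x \<subseteq> carrier B"
  by (auto simp: theta_class_def theta_closed)

lemma theta_in_class:
  "\<lbrakk>a \<in> carrier B; b \<in> carrier B\<rbrakk> \<Longrightarrow> theta B a b x \<in> theta_class B x"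
  by (auto simp: theta_class_def)

lemma theta_class_closed:
  assumes "x \<in> carrier B" "a \<in> carrier B" "b \<in> carrier B" "y \<in> theta_class B x"
  shows "theta B a b y \<in> theta_class B x"
proof -
  obtain c d where "c \<in> carrier B" "d \<in> carrier B" "y = theta B c d x"
    using assms(4) by (auto simp: theta_class_def)
  then show ?thesis
    using assms theta_in_class by (simp add: theta_theta a_simps lam_closed)
qed

lemma lam_in_class:
  "\<lbrakk>b \<in> carrier B; x \<in> carrier B\<rbrakk> \<Longrightarrow> lam B b x \<in> theta_class B x"
  using theta_in_class[of \<zero> b x] by (simp add: theta_lam a_simps)

lemma finite_additive_class:
  assumes "t \<in> carrier B" "finite (theta_class B t)"
  shows "finite {g \<otimes>\<^bsub>add_monoid B\<^esub> t \<otimes>\<^bsub>add_monoid B\<^esub> inv\<^bsub>add_monoid B\<^esub> g | g. g \<in> carrier (add_monoid B)}"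
  by (rule finite_subset[OF _ assms(2)])
     (use assms(1) theta_in_class[of _ \<one> t] theta_conj[of _ t] in \<open>auto simp: a_inv_def\<close>)

lemma theta_class_subset_strong_left_ideal:
  assumes L: "strong_left_ideal L B" and x: "x \<in> L"
  shows "theta_class B x \<subseteq> L"
proof
  have n: "L \<lhd> add_monoid B" and l: "\<And>b. b \<in> carrier B \<Longrightarrow> lam B b ` L = L"
    using L by (auto simp: strong_left_ideal_def)
  fix y assume "y \<in> theta_class B x"
  then obtain a b where ab: "a \<in> carrier B" "b \<in> carrier B" "y = theta B a b x"
    by (auto simp: theta_class_def)
  then have "lam B b x \<in> L" using l x by blast
  then show "y \<in> L"
    using add.normal_invE(2)[OF n, of a "lam B b x"] ab by (simp add: theta_eq a_inv_def)
qed

lemma strong_left_ideal_generate_theta_class: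
  assumes x: "x \<in> carrier B"
  shows "strong_left_ideal (generate (add_monoid B) (theta_class B x)) B"
  unfolding strong_left_ideal_def
proof (intro conjI ballI)
  let ?X = "theta_class B x"
  note sub = theta_class_subset[OF x]
  show "generate (add_monoid B) ?X \<lhd> add_monoid B"
  proof (rule add.normal_generateI)
    fix h g assume "h \<in> ?X" "g \<in> carrier (add_monoid B)"
    then show "g \<otimes>\<^bsub>add_monoid B\<^esub> h \<otimes>\<^bsub>add_monoid B\<^esub> inv\<^bsub>add_monoid B\<^esub> g \<in> ?X"
      using theta_class_closed[OF x, of g \<one> h] theta_conj[of g h] sub by (auto simp: a_inv_def)
  qed (use sub in simp)
  fix b assume b: "b \<in> carrier B"
  have l: "lam B c y \<in> ?X" if "c \<in> carrier B" "y \<in> ?X" for c y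
    using theta_class_closed[OF x _ _ that(2), of \<zero> c] theta_lam[of c y] that sub z_closed by auto
  have "lam B b ` ?X = ?X"
  proof
    show "?X \<subseteq> lam B b ` ?X"
    proof
      fix y assume y: "y \<in> ?X"
      have "y = lam B b (lam B (inv b) y)" using y sub b by (simp add: lam_lam_inv subset_iff)
      then show "y \<in> lam B b ` ?X" using l[of "inv b" y] b y by blast
    qed
  qed (use l b in auto)
  then show "lam B b ` generate (add_monoid B) ?X = generate (add_monoid B) ?X"
    using group_hom.generate_img[OF lam_group_hom[OF b], of ?X] sub by simp
qed

section \<open>Sub skew braces\<close>

lemma sub_skew_brace_lam:
  assumes "sub_skew_brace S B" "a \<in> S" "b \<in> S"
  shows "lam B a b \<in> S"
proof -
  have A: "subgroup S (add_monoid B)" and M: "subgroup S B" using assms by (auto simp: sub_skew_brace_def)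
  have "b \<in> carrier B" using assms subgroup.subset[OF M] by auto
  then show ?thesis
    using assms subgroup.m_closed[OF A, of "\<ominus> a" "a \<otimes> b"] subgroup.m_inv_closed[OF A, of a]
      subgroup.m_closed[OF M, of a b]
    by (simp add: lam_eq a_inv_def)
qed

text \<open>
  Closure under \<open>\<circ>\<close> and its inverses follows from \<open>a \<circ> b = a + \<lambda>\<^sub>a(b)\<close> and \<open>a\<^sup>-\<^sup>1 = -\<lambda>\<^sub>c(a)\<close>
  with \<open>c = a\<^sup>-\<^sup>1\<close>.
\<close>
lemma strong_left_ideal_sub:
  assumes "strong_left_ideal L B"
  shows "sub_skew_brace L B"
proof -
  have A: "subgroup L (add_monoid B)" and l: "\<And>b. b \<in> carrier B \<Longrightarrow> lam B b ` L = L"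
    using assms by (auto simp: strong_left_ideal_def normal_imp_subgroup)
  have sub: "L \<subseteq> carrier B" using subgroup.subset[OF A] by simp
  have "subgroup L B"
  proof (rule subgroup.intro)
    fix x y assume xy: "x \<in> L" "y \<in> L"
    then have "lam B x y \<in> L" using l sub by blast
    then show "x \<otimes> y \<in> L"
      using xy subgroup.m_closed[OF A, of x "lam B x y"] mult_eq[OF subsetD[OF sub] subsetD[OF sub]] by simp
  next
    fix x assume x: "x \<in> L"
    then have "lam B (inv x) x \<in> L" using l sub by blast
    then show "inv x \<in> L"
      using inv_eq_minus_lam[OF subsetD[OF sub x]] subgroup.m_inv_closed[OF A, of "lam B (inv x) x"]
      by (simp add: a_inv_def)
  qed (use sub subgroup.one_closed[OF A] in \<open>auto simp: one_eq_zero\<close>)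
  then show ?thesis using A by (simp add: sub_skew_brace_def)
qed

lemma sub_skew_brace_is_skew_brace:
  assumes "sub_skew_brace S B"
  shows "skew_brace (B\<lparr>carrier := S\<rparr>)"
proof -
  have A: "subgroup S (add_monoid B)" and M: "subgroup S B" using assms by (auto simp: sub_skew_brace_def)
  have sub: "S \<subseteq> carrier B" using subgroup.subset[OF M] .
  have inv: "\<ominus>\<^bsub>B\<lparr>carrier := S\<rparr>\<^esub> x = \<ominus> x" if "x \<in> S" for x
    using add.m_inv_consistent[OF A that] by (simp add: a_inv_def)
  have "group (add_monoid (B\<lparr>carrier := S\<rparr>))"
    using add.subgroup_imp_group[OF A] by simp
  then show ?thesis
    using brace sub by (intro skew_brace.intro subgroup_imp_group[OF M] skew_brace_axioms.intro)
      (auto simp: a_minus_def inv subset_iff)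
qed

lemma sub_skew_brace_restrict:
  assumes "sub_skew_brace S B" "R \<subseteq> S"
  shows "sub_skew_brace R (B\<lparr>carrier := S\<rparr>) \<longleftrightarrow> sub_skew_brace R B"
  using assms subgroup_incl[of R S] incl_subgroup[of S R] add.subgroup_incl[of R S] add.incl_subgroup[of S R]
  by (auto simp: sub_skew_brace_def)

text \<open>
  This expresses finite generation of \<open>S\<close> by sub skew braces of \<open>B\<close>, without the restricted
  structure.
\<close>
lemma finitely_generated_iff:
  assumes S: "sub_skew_brace S B"
  shows "finitely_generated_skew_brace (B\<lparr>carrier := S\<rparr>) \<longleftrightarrow>
    (\<exists>F. finite F \<and> F \<subseteq> S \<and> (\<forall>R. sub_skew_brace R B \<longrightarrow> F \<subseteq> R \<longrightarrow> R \<subseteq> S \<longrightarrow> R = S))"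
proof -
  have in_S: "R \<subseteq> S" if "sub_skew_brace R (B\<lparr>carrier := S\<rparr>)" for R
    using that subgroup.subset[of R "B\<lparr>carrier := S\<rparr>"] by (simp add: sub_skew_brace_def)
  have "sub_skew_brace_generated (B\<lparr>carrier := S\<rparr>) F = S \<longleftrightarrow>
      (\<forall>R. sub_skew_brace R B \<longrightarrow> F \<subseteq> R \<longrightarrow> R \<subseteq> S \<longrightarrow> R = S)" if "F \<subseteq> S" for F
  proof -
    have "{R. sub_skew_brace R (B\<lparr>carrier := S\<rparr>) \<and> F \<subseteq> R} = {R. sub_skew_brace R B \<and> F \<subseteq> R \<and> R \<subseteq> S}"
      using in_S sub_skew_brace_restrict[OF S] by blast
    then show ?thesis unfolding sub_skew_brace_generated_def using S that by auto
  qed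
  then show ?thesis
    unfolding finitely_generated_skew_brace_def using sub_skew_brace_is_skew_brace[OF S] by auto
qed

section \<open>The quotient by an ideal\<close>

lemma quot_hom:
  assumes I: "skew_brace_ideal I B"
  shows "group_hom B (B Quot I) (\<lambda>x. I +> x)"
    and "group_hom (add_monoid B) (add_monoid (B Quot I)) (\<lambda>x. I +> x)"
proof -
  interpret Q: skew_brace "B Quot I" by (rule quot_skew_brace[OF I])
  show "group_hom B (B Quot I) (\<lambda>x. I +> x)"
    by unfold_locales (auto simp: hom_def quot_carrier quot_mult[OF I])
  show "group_hom (add_monoid B) (add_monoid (B Quot I)) (\<lambda>x. I +> x)"
    by unfold_locales (auto simp: hom_def quot_carrier quot_add[OF I])
qed

lemma quot_minus:
  "skew_brace_ideal I B \<Longrightarrow> x \<in> carrier B \<Longrightarrow> \<ominus>\<^bsub>B Quot I\<^esub> (I +> x) = I +> \<ominus> x"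
  using group_hom.hom_inv[OF quot_hom(2)[of I], of x] by (simp add: a_inv_def)

lemma quot_theta:
  assumes I: "skew_brace_ideal I B" and "a \<in> carrier B" "b \<in> carrier B" "x \<in> carrier B"
  shows "theta (B Quot I) (I +> a) (I +> b) (I +> x) = I +> theta B a b x"
proof -
  interpret Q: skew_brace "B Quot I" by (rule quot_skew_brace[OF I])
  show ?thesis
    using assms by (simp add: theta_eq Q.theta_eq lam_eq Q.lam_eq quot_carrier quot_minus quot_add quot_mult a_simps lam_closed)
qed

lemma quot_theta_class:
  assumes I: "skew_brace_ideal I B" and x: "x \<in> carrier B"
  shows "theta_class (B Quot I) (I +> x) = (\<lambda>y. I +> y) ` theta_class B x"
  unfolding theta_class_def quot_carrier
proof safe
  fix a b assume "a \<in> carrier B" "b \<in> carrier B"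
  then show "theta (B Quot I) (I +> a) (I +> b) (I +> x) \<in>
      (\<lambda>y. I +> y) ` {theta B a b x |a b. a \<in> carrier B \<and> b \<in> carrier B}"
    using quot_theta[OF I _ _ x] by blast
  show "\<exists>c d. I +> theta B a b x = theta (B Quot I) c d (I +> x) \<and>
      c \<in> (\<lambda>x. I +> x) ` carrier B \<and> d \<in> (\<lambda>x. I +> x) ` carrier B"
    using quot_theta[OF I \<open>a \<in> carrier B\<close> \<open>b \<in> carrier B\<close> x] \<open>a \<in> carrier B\<close> \<open>b \<in> carrier B\<close> by auto
qed

lemma quot_eqD:
  assumes I: "skew_brace_ideal I B" and x: "x \<in> carrier B" and y: "y \<in> carrier B"
    and eq: "I +> x = I +> y"
  shows "\<exists>i\<in>I. x = i \<oplus> y"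
proof -
  have "subgroup I (add_monoid B)"
    using I by (auto simp: skew_brace_ideal_def strong_left_ideal_def normal_imp_subgroup)
  then have "x \<in> I +> x" using add.rcos_self[of x I] x by (simp add: a_r_coset_def)
  then show ?thesis unfolding eq by (auto simp: a_r_coset_def r_coset_def)
qed

lemma quot_zero_iff:
  assumes I: "skew_brace_ideal I B" and x: "x \<in> carrier B"
  shows "I +> x = \<zero>\<^bsub>B Quot I\<^esub> \<longleftrightarrow> x \<in> I"
proof -
  have A: "subgroup I (add_monoid B)"
    using I by (auto simp: skew_brace_ideal_def strong_left_ideal_def normal_imp_subgroup)
  have "subgroup I B" using I by (auto simp: skew_brace_ideal_def normal_imp_subgroup)
  have sub: "I \<subseteq> carrier B" using subgroup.subset[OF A] by simp
  show ?thesis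
  proof
    assume "I +> x = \<zero>\<^bsub>B Quot I\<^esub>"
    then obtain i where "i \<in> I" "x = i \<oplus> \<zero>"
      using quot_eqD[OF I x z_closed] by (auto simp: quot_zero[OF I])
    then show "x \<in> I" using sub by (auto simp: rz)
  next
    assume "x \<in> I"
    then have "x \<in> I +> \<zero>" using sub by (force simp: a_r_coset_def r_coset_def rz)
    then have "I +> \<zero> = I +> x"
      using add.repr_independence[OF _ _ A, of x \<zero>] z_closed by (simp add: a_r_coset_def)
    then show "I +> x = \<zero>\<^bsub>B Quot I\<^esub>" by (simp add: quot_zero[OF I])
  qed
qed

section \<open>From finite classes to finite strong left ideals\<close>

lemma lam_finite_order_iff:
  assumes b: "b \<in> carrier B"
  shows "lam_finite_order B b \<longleftrightarrow> (\<exists>n::nat>0. \<forall>x\<in>carrier B. lam B (b [^] n) x = x)"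
proof -
  interpret A: group "AutoGroup (add_monoid B)" by (rule add.AutoGroup)
  interpret l: group_hom B "AutoGroup (add_monoid B)" "lam B" by unfold_locales (rule lam_hom)
  have one: "f = \<one>\<^bsub>AutoGroup (add_monoid B)\<^esub> \<longleftrightarrow> f = (\<lambda>x\<in>carrier B. x)" for f
    by (simp add: AutoGroup_def BijGroup_def)
  have "lam B c = \<one>\<^bsub>AutoGroup (add_monoid B)\<^esub> \<longleftrightarrow> (\<forall>x\<in>carrier B. lam B c x = x)" for c
    unfolding one by (auto simp: lam_def fun_eq_iff)
  then show ?thesis
    unfolding lam_finite_order_def using A.ord_eq_0[of "lam B b"] b by (auto simp flip: l.hom_nat_pow)
qed

lemma pow_eq_add_pow:
  assumes c: "c \<in> carrier B" and fix_c: "lam B c c = c"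
  shows "c [^] (n::nat) = multiple n c"
proof -
  have l: "lam B (c [^] n) c = c" for n :: nat
    by (induction n) (use c in \<open>auto simp: lam_one lam_mult fix_c\<close>)
  show ?thesis
  proof (induction n)
    case (Suc n)
    have "c [^] Suc n = c [^] n \<oplus> c" using c mult_eq[of "c [^] n" c] by (simp add: l)
    then show ?case using Suc by (simp add: add_pow_Suc)
  qed (simp add: add_pow_0 one_eq_zero)
qed

text \<open>
  By the pigeonhole principle \<open>\<lambda>\<^bsub>ix\<^esub>\<^sup>-\<^sup>1 x = \<lambda>\<^bsub>jx\<^esub>\<^sup>-\<^sup>1 x\<close> for some \<open>i < j\<close>. Then \<open>(jx) \<circ>
  (ix)\<^sup>-\<^sup>1\<close> acts trivially on \<open>x\<close>, hence on \<open>ix\<close>, and therefore equals \<open>(j - i)x\<close>.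
\<close>
lemma some_multiple_fixes:
  assumes x: "x \<in> carrier B" and fin: "finite (theta_class B x)"
  shows "\<exists>k::nat>0. lam B (multiple k x) x = x"
proof -
  note pc = add_pow_closed[OF x]
  obtain i j :: nat where ij: "i < j" and eq: "lam B (inv (multiple i x)) x = lam B (inv (multiple j x)) x"
    by (rule nat_pigeonhole[OF fin, of "\<lambda>i. lam B (inv (multiple i x)) x"])
       (use x pc lam_in_class in auto)
  define c where "c = multiple (j - i) x"
  define d where "d = multiple j x \<otimes> inv (multiple i x)"
  have cc: "c \<in> carrier B" and dc: "d \<in> carrier B" using pc by (auto simp: c_def d_def)
  have "lam B d x = x" using x pc eq by (simp add: d_def lam_mult lam_lam_inv)
  then have "lam B d (multiple i x) = multiple i x" using dc x by (simp add: lam_add_pow)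
  then have "d \<oplus> multiple i x = d \<otimes> multiple i x" using mult_eq[OF dc pc] by simp
  also have "\<dots> = multiple j x" using pc by (simp add: d_def m_assoc)
  also have "\<dots> = c \<oplus> multiple i x"
    using add.nat_pow_mult[of x "j - i" i] x ij by (simp add: c_def add_pow_def)
  finally have "d = c" using add.r_cancel[of d "multiple i x" c] pc cc dc by simp
  then show ?thesis using \<open>lam B d x = x\<close> ij by (intro exI[of _ "j - i"]) (auto simp: c_def)
qed

text \<open>
  A multiple \<open>c\<close> of \<open>x\<close> that \<open>\<lambda>\<^sub>c\<close> fixes has a multiple \<open>z = c\<^sup>n\<close> that acts trivially, and the
  additively central multiple \<open>mz = z\<^sup>m\<close> still acts trivially.
\<close>
lemma some_multiple_in_socle:
  assumes x: "x \<in> carrier B" and fin: "\<And>y. y \<in> carrier B \<Longrightarrow> finite (theta_class B y)"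
    and ord: "\<And>b. b \<in> carrier B \<Longrightarrow> lam_finite_order B b"
  shows "\<exists>n::nat>0. multiple n x \<in> socle B"
proof -
  obtain k :: nat where k: "k > 0" "lam B (multiple k x) x = x"
    using some_multiple_fixes[OF x fin[OF x]] by auto
  define c where "c = multiple k x"
  have c: "c \<in> carrier B" "lam B c c = c"
    using x k(2) by (auto simp: c_def lam_add_pow add_pow_closed)
  obtain n :: nat where n: "n > 0" "\<forall>y\<in>carrier B. lam B (c [^] n) y = y"
    using ord[OF c(1)] lam_finite_order_iff[OF c(1)] by blast
  define z where "z = c [^] n"
  have z: "z \<in> carrier B" "\<And>y. y \<in> carrier B \<Longrightarrow> lam B z y = y"
    using c n by (auto simp: z_def)
  obtain m :: nat where m: "m > 0"
      and cent: "\<And>g. g \<in> carrier B \<Longrightarrow> multiple m z \<oplus> g = g \<oplus> multiple m z"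
    by (rule add.some_power_central[of z])
       (use z finite_additive_class fin in \<open>auto simp: add_pow_def\<close>)
  have "lam B (z [^] m) y = y" if "y \<in> carrier B" for y
    by (induction m) (use z that in \<open>auto simp: lam_one lam_mult\<close>)
  then have "multiple m z \<in> socle B"
    using pow_eq_add_pow[OF z(1), of m] z cent add_pow_closed[OF z(1)] by (auto simp: socle_eq)
  moreover have "multiple m z = multiple (k * n * m) x"
    using pow_eq_add_pow[OF c] x add.nat_pow_pow[of x] by (simp add: z_def c_def add_pow_def)
  ultimately show ?thesis using k n m by (intro exI[of _ "k * n * m"]) auto
qed

text \<open>
  The class of \<open>x\<close> is closed under additive conjugation, as Dietzmann's lemma requires.
\<close>
lemma finite_strong_left_ideal_of_torsion_class:
  assumes x: "x \<in> carrier B" and fin: "finite (theta_class B x)"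
    and tor: "\<And>y. y \<in> theta_class B x \<Longrightarrow> \<exists>n::nat>0. multiple n y = \<zero>"
  shows "\<exists>L. strong_left_ideal L B \<and> finite L \<and> x \<in> L"
proof -
  let ?X = "theta_class B x"
  note sub = theta_class_subset[OF x]
  have "finite (generate (add_monoid B) ?X)"
  proof (rule add.finite_generate_torsion[OF fin])
    fix y z assume "y \<in> ?X" "z \<in> ?X"
    then show "inv\<^bsub>add_monoid B\<^esub> y \<otimes>\<^bsub>add_monoid B\<^esub> z \<otimes>\<^bsub>add_monoid B\<^esub> y \<in> ?X"
      using theta_class_closed[OF x, of "\<ominus> y" \<one> z] theta_conj[of "\<ominus> y" z] sub n_closed minus_minus
      by (auto simp: a_inv_def subset_iff)
  qed (use sub tor in \<open>auto simp: add_pow_def\<close>)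
  then show ?thesis
    using strong_left_ideal_generate_theta_class[OF x] theta_class_self[OF x] by (blast intro: generate.incl)
qed

lemma quot_add_pow:
  assumes I: "skew_brace_ideal I B" and x: "x \<in> carrier B"
  shows "add_pow (B Quot I) (n::nat) (I +> x) = I +> multiple n x"
  using group_hom.hom_nat_pow[OF quot_hom(2)[OF I], of x n] x by (simp add: add_pow_def)

lemma finite_strong_left_ideals_in_quotient:
  assumes fin: "\<And>y. y \<in> carrier B \<Longrightarrow> finite (theta_class B y)"
    and ord: "\<And>b. b \<in> carrier B \<Longrightarrow> lam_finite_order B b"
    and C: "C \<in> carrier (B Quot socle B)"
  shows "\<exists>L. strong_left_ideal L (B Quot socle B) \<and> finite L \<and> C \<in> L"
proof -
  interpret Q: skew_brace "B Quot socle B" by (rule quot_socle_skew_brace)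
  obtain x where x: "x \<in> carrier B" "C = socle B +> x" using C by (auto simp: quot_carrier)
  have X: "theta_class (B Quot socle B) C = (\<lambda>y. socle B +> y) ` theta_class B x"
    using quot_theta_class[OF socle_ideal x(1)] x(2) by simp
  show ?thesis
  proof (rule Q.finite_strong_left_ideal_of_torsion_class[OF C])
    show "finite (theta_class (B Quot socle B) C)" using X fin[OF x(1)] by simp
    fix D assume "D \<in> theta_class (B Quot socle B) C"
    then obtain y where "y \<in> theta_class B x" and D: "D = socle B +> y" using X by auto
    then have y: "y \<in> carrier B" using theta_class_subset[OF x(1)] by auto
    obtain n :: nat where "n > 0" "multiple n y \<in> socle B"
      using some_multiple_in_socle[OF y fin ord] by auto
    then show "\<exists>n::nat>0. Q.multiple n D = \<zero>\<^bsub>B Quot socle B\<^esub>"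
      using quot_zero_iff[OF socle_ideal add_pow_closed[OF y]] quot_add_pow[OF socle_ideal y] D by auto
  qed
qed

text \<open>
  The additive subgroup generated by the class is a strong left ideal, and the class generates
  it as a skew brace.
\<close>
lemma finitely_generated_strong_left_ideal_of_finite_class:
  assumes x: "x \<in> carrier B" and fin: "finite (theta_class B x)"
  shows "\<exists>L. strong_left_ideal L B \<and> x \<in> L \<and> finitely_generated_skew_brace (B\<lparr>carrier := L\<rparr>)"
proof -
  define L where "L = generate (add_monoid B) (theta_class B x)"
  have L: "strong_left_ideal L B" unfolding L_def by (rule strong_left_ideal_generate_theta_class[OF x])
  have "R = L" if "sub_skew_brace R B" "theta_class B x \<subseteq> R" "R \<subseteq> L" for R
    using that add.generate_subgroup_incl[of "theta_class B x" R] by (auto simp: sub_skew_brace_def L_def)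
  moreover have "theta_class B x \<subseteq> L" by (auto simp: L_def intro: generate.incl)
  ultimately show ?thesis
    using L fin finitely_generated_iff[OF strong_left_ideal_sub[OF L]] theta_class_self[OF x] by blast
qed

section \<open>From finite strong left ideals of the quotient to finite classes\<close>

lemma strong_left_ideal_set_mult:
  assumes M: "strong_left_ideal M B" and N: "strong_left_ideal N B"
  shows "strong_left_ideal (M <#>\<^bsub>add_monoid B\<^esub> N) B"
proof -
  have n: "M \<lhd> add_monoid B" "N \<lhd> add_monoid B" using M N by (auto simp: strong_left_ideal_def)
  then have sub: "M \<subseteq> carrier B" "N \<subseteq> carrier B"
    using subgroup.subset normal_imp_subgroup by fastforce+
  have "lam B b ` (M <#>\<^bsub>add_monoid B\<^esub> N) = M <#>\<^bsub>add_monoid B\<^esub> N" if b: "b \<in> carrier B" for b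
  proof -
    have "lam B b ` (M <#>\<^bsub>add_monoid B\<^esub> N) = lam B b ` M <#>\<^bsub>add_monoid B\<^esub> lam B b ` N"
      using sub b by (force simp: set_mult_def lam_add subset_iff)
    then show ?thesis using M N b by (simp add: strong_left_ideal_def)
  qed
  then show ?thesis
    using add.normal_subgroup_set_mult_closed[OF n] by (simp add: strong_left_ideal_def)
qed

lemma finite_set_in_finite_strong_left_ideal:
  assumes "finite K" "K \<subseteq> carrier B"
    and ex: "\<And>x. x \<in> carrier B \<Longrightarrow> \<exists>L. strong_left_ideal L B \<and> finite L \<and> x \<in> L"
  shows "\<exists>L. strong_left_ideal L B \<and> finite L \<and> K \<subseteq> L"
  using assms(1,2)
proof (induction K rule: finite_induct)
  case empty
  then show ?case using ex[OF one_closed] by auto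
next
  case (insert x K)
  obtain M where M: "strong_left_ideal M B" "finite M" "K \<subseteq> M" using insert by auto
  obtain N where N: "strong_left_ideal N B" "finite N" "x \<in> N" using ex[of x] insert.prems by auto
  let ?L = "M <#>\<^bsub>add_monoid B\<^esub> N"
  have sM: "subgroup M (add_monoid B)" and sN: "subgroup N (add_monoid B)"
    using M N by (auto simp: strong_left_ideal_def normal_imp_subgroup)
  have zero: "\<zero> \<in> M" "\<zero> \<in> N" using subgroup.one_closed[OF sM] subgroup.one_closed[OF sN] by auto
  have "x = \<zero> \<oplus> x" using insert.prems lz by auto
  moreover have "y = y \<oplus> \<zero>" if "y \<in> K" for y using insert.prems that rz by auto
  ultimately have "insert x K \<subseteq> ?L" using zero M(3) N(3) by (fastforce simp: set_mult_def)
  moreover have "finite ?L" using M N by (simp add: set_mult_def)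
  ultimately show ?case using strong_left_ideal_set_mult[OF M(1) N(1)] by blast
qed

text \<open>
  The powers of the coset of \<open>b\<close> stay in the finite set \<open>L\<close>, so some power of \<open>b\<close> lies in the
  socle and acts trivially.
\<close>
lemma lam_finite_order_of_finite_strong_left_ideals:
  assumes b: "b \<in> carrier B"
    and L: "strong_left_ideal L (B Quot socle B)" "finite L" "socle B +> b \<in> L"
  shows "lam_finite_order B b"
proof -
  interpret Q: skew_brace "B Quot socle B" by (rule quot_socle_skew_brace)
  interpret h: group_hom B "B Quot socle B" "\<lambda>x. socle B +> x" by (rule quot_hom(1)[OF socle_ideal])
  have "subgroup L (B Quot socle B)"
    using Q.strong_left_ideal_sub[OF L(1)] by (simp add: sub_skew_brace_def)
  then have "(socle B +> b) [^]\<^bsub>B Quot socle B\<^esub> (i::nat) \<in> L" for i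
    using L(3) by (induction i) (auto simp: subgroup.one_closed subgroup.m_closed)
  then obtain i j :: nat where ij: "i < j"
      "(socle B +> b) [^]\<^bsub>B Quot socle B\<^esub> i = (socle B +> b) [^]\<^bsub>B Quot socle B\<^esub> j"
    using nat_pigeonhole[OF L(2)] by metis
  have "(socle B +> b) [^]\<^bsub>B Quot socle B\<^esub> (j - i) = \<one>\<^bsub>B Quot socle B\<^esub>"
    using Q.pow_eq_div2[of "socle B +> b" j i] ij b by simp
  then have "socle B +> (b [^] (j - i)) = \<zero>\<^bsub>B Quot socle B\<^esub>"
    using b by (simp add: h.hom_nat_pow Q.one_eq_zero)
  then have "b [^] (j - i) \<in> socle B"
    using quot_zero_iff[OF socle_ideal] b by simp
  then show ?thesis
    using lam_finite_order_iff[OF b] ij(1) by (intro iffD2[OF lam_finite_order_iff[OF b]] exI[of _ "j - i"]) (auto simp: socle_eq)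
qed

lemma socle_add_mult: "s \<in> socle B \<Longrightarrow> y \<in> carrier B \<Longrightarrow> s \<oplus> y = s \<otimes> y"
  by (simp add: mult_eq socle_eq)

text \<open>
  Reduction modulo an ideal maps \<open>S\<close> into \<open>M\<close> since the preimage of \<open>M\<close> is a sub skew brace that
  contains generators of \<open>S\<close>.
\<close>
lemma quot_image_subset:
  assumes I: "skew_brace_ideal I B" and S: "sub_skew_brace S B"
    and gen: "\<And>R. sub_skew_brace R B \<Longrightarrow> F \<subseteq> R \<Longrightarrow> R \<subseteq> S \<Longrightarrow> R = S" and F: "F \<subseteq> S"
    and M: "sub_skew_brace M (B Quot I)" and FM: "(\<lambda>x. I +> x) ` F \<subseteq> M"
  shows "(\<lambda>x. I +> x) ` S \<subseteq> M"
proof -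
  interpret Q: skew_brace "B Quot I" by (rule quot_skew_brace[OF I])
  interpret h: group_hom B "B Quot I" "\<lambda>x. I +> x" by (rule quot_hom(1)[OF I])
  have SA: "subgroup S (add_monoid B)" and SM: "subgroup S B"
    and MA: "subgroup M (add_monoid (B Quot I))" and MM: "subgroup M (B Quot I)"
    using S M by (auto simp: sub_skew_brace_def)
  have sub: "S \<subseteq> carrier B" using subgroup.subset[OF SM] .
  define P where "P = {y \<in> S. I +> y \<in> M}"
  have P: "x \<in> S" "x \<in> carrier B" "I +> x \<in> M" if "x \<in> P" for x
    using that sub by (auto simp: P_def)
  have PI: "x \<in> P" if "x \<in> S" "I +> x \<in> M" for x using that by (simp add: P_def)
  have P_sub: "P \<subseteq> carrier B" using P by blast
  have "subgroup P (add_monoid B)"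
  proof (rule subgroup.intro)
    fix x y assume xy: "x \<in> P" "y \<in> P"
    have "x \<oplus> y \<in> S" using subgroup.m_closed[OF SA P(1)[OF xy(1)] P(1)[OF xy(2)]] by simp
    moreover have "I +> (x \<oplus> y) \<in> M"
      using subgroup.m_closed[OF MA P(3)[OF xy(1)] P(3)[OF xy(2)]]
        quot_add[OF I P(2)[OF xy(1)] P(2)[OF xy(2)]] by simp
    ultimately show "x \<otimes>\<^bsub>add_monoid B\<^esub> y \<in> P" using PI by simp
  next
    fix x assume x: "x \<in> P"
    have "\<ominus> x \<in> S" using subgroup.m_inv_closed[OF SA P(1)[OF x]] by (simp add: a_inv_def)
    moreover have "\<ominus>\<^bsub>B Quot I\<^esub> (I +> x) \<in> M"
      using subgroup.m_inv_closed[OF MA P(3)[OF x]] by (simp add: a_inv_def)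
    ultimately have "\<ominus> x \<in> P" using quot_minus[OF I P(2)[OF x]] PI by simp
    then show "inv\<^bsub>add_monoid B\<^esub> x \<in> P" by (simp add: a_inv_def)
  next
    show "\<one>\<^bsub>add_monoid B\<^esub> \<in> P"
      using subgroup.one_closed[OF SA] subgroup.one_closed[OF MA] quot_zero(1)[OF I] PI by simp
  qed (use P_sub in simp)
  moreover have "subgroup P B"
  proof (rule subgroup.intro)
    fix x y assume xy: "x \<in> P" "y \<in> P"
    have "I +> (x \<otimes> y) \<in> M"
      using subgroup.m_closed[OF MM P(3)[OF xy(1)] P(3)[OF xy(2)]]
        quot_mult[OF I P(2)[OF xy(1)] P(2)[OF xy(2)]] by simp
    then show "x \<otimes> y \<in> P" using PI subgroup.m_closed[OF SM P(1)[OF xy(1)] P(1)[OF xy(2)]] by simp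
  next
    fix x assume x: "x \<in> P"
    have "I +> inv x \<in> M" using subgroup.m_inv_closed[OF MM P(3)[OF x]] h.hom_inv[OF P(2)[OF x]] by simp
    then show "inv x \<in> P" using PI subgroup.m_inv_closed[OF SM P(1)[OF x]] by simp
  next
    show "\<one> \<in> P" using subgroup.one_closed[OF SM] subgroup.one_closed[OF MM] h.hom_one PI by simp
  qed (rule P_sub)
  ultimately have "P = S"
    using F FM by (intro gen) (auto simp: P_def sub_skew_brace_def)
  then show ?thesis by (auto simp: P_def)
qed

text \<open>
  A Schreier-type argument. The finitely many sums, products and inverses of the representatives
  differ from representatives by elements of a finite subset \<open>E\<close> of the socle. Let \<open>A\<close> be the
  additive group generated by the images of \<open>E\<close> under the action of \<open>S\<close>; these images are finite
  in number, as the socle acts trivially. Then the sums of elements of \<open>A\<close> and representatives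
  form a sub skew brace that contains \<open>F\<close>, hence all of \<open>S\<close>.
\<close>
lemma finitely_generated_socle_part:
  assumes S: "sub_skew_brace S B"
    and gen: "\<And>R. sub_skew_brace R B \<Longrightarrow> F \<subseteq> R \<Longrightarrow> R \<subseteq> S \<Longrightarrow> R = S"
    and F: "finite F" "F \<subseteq> S" and T0: "finite T0" "T0 \<subseteq> S"
    and cover: "\<And>y. y \<in> S \<Longrightarrow> \<exists>s\<in>S \<inter> socle B. \<exists>t\<in>T0. y = s \<oplus> t"
  shows "\<exists>V. finite V \<and> V \<subseteq> S \<inter> socle B \<and> generate (add_monoid B) V = S \<inter> socle B"
proof -
  have SA: "subgroup S (add_monoid B)" and SM: "subgroup S B" using S by (auto simp: sub_skew_brace_def)
  have sub: "S \<subseteq> carrier B" using subgroup.subset[OF SM] .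
  have S_add: "x \<oplus> y \<in> S" if "x \<in> S" "y \<in> S" for x y using subgroup.m_closed[OF SA that] by simp
  have S_minus: "\<ominus> x \<in> S" if "x \<in> S" for x using subgroup.m_inv_closed[OF SA that] by (simp add: a_inv_def)
  have S_mult: "x \<otimes> y \<in> S" if "x \<in> S" "y \<in> S" for x y using subgroup.m_closed[OF SM that] .
  have S_inv: "inv x \<in> S" if "x \<in> S" for x using subgroup.m_inv_closed[OF SM that] .
  have S_zero: "\<zero> \<in> S" using subgroup.one_closed[OF SA] by simp
  have soc_sub: "socle B \<subseteq> carrier B" by (auto simp: socle_eq)
  have soc_comm: "z \<oplus> y = y \<oplus> z" if "z \<in> socle B" "y \<in> carrier B" for z y
    using that by (simp add: socle_eq)
  have "socle B \<lhd> add_monoid B" using socle_ideal by (simp add: skew_brace_ideal_def strong_left_ideal_def)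
  then have "subgroup (socle B) (add_monoid B)" by (rule normal_imp_subgroup)
  then have I_sub: "subgroup (S \<inter> socle B) (add_monoid B)" using SA by (rule add.subgroups_Inter_pair[rotated])
  \<comment> \<open>Including \<open>F\<close> and \<open>\<zero>\<close> among the representatives makes \<open>A + T\<close> contain the generators and \<open>E\<close> lie in \<open>A\<close>.\<close>
  define T where "T = insert \<zero> (T0 \<union> F)"
  have T: "finite T" "T \<subseteq> S" "\<zero> \<in> T" using F T0 S_zero by (auto simp: T_def)
  have T_S: "t \<in> S" if "t \<in> T" for t using that T(2) by blast
  define W where "W = (\<lambda>(t, u). t \<oplus> u) ` (T \<times> T) \<union> (\<lambda>(t, u). t \<otimes> u) ` (T \<times> T) \<union> a_inv B ` T \<union> m_inv B ` T"
  have W: "finite W" "W \<subseteq> S" using T(1) S_add S_mult S_minus S_inv by (auto simp: W_def T_S)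
  define E where "E = (\<lambda>(w, t). w \<ominus> t) ` (W \<times> T) \<inter> socle B"
  have E: "finite E" "E \<subseteq> S \<inter> socle B"
    using T(1) W(1) S_add S_minus subsetD[OF W(2)] by (auto simp: E_def a_minus_def T_S)
  have W_E: "\<exists>e\<in>E. \<exists>t\<in>T. w = e \<oplus> t" if w: "w \<in> W" for w
  proof -
    obtain s t where st: "s \<in> S \<inter> socle B" "t \<in> T0" "w = s \<oplus> t" using cover w W by blast
    then have "t \<in> T" "t \<in> carrier B" "s \<in> carrier B" using T T0 sub by (auto simp: T_def)
    then have "w \<ominus> t = s" using st by (simp add: a_minus_def a_ass a_simps)
    then have "s \<in> E" using st w \<open>t \<in> T\<close> by (force simp: E_def)
    then show ?thesis using st \<open>t \<in> T\<close> by blast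
  qed
  define U where "U = (\<lambda>(t, e). lam B t e) ` (T \<times> E)"
  have lam_S: "lam B y s \<in> S \<inter> socle B" if "y \<in> S" "s \<in> S \<inter> socle B" for y s
    using that sub_skew_brace_lam[OF S] socle_conj(2)[of s y] sub by auto
  have U: "finite U" "U \<subseteq> S \<inter> socle B" using T E lam_S by (auto simp: U_def subset_iff)
  then have Uc: "U \<subseteq> carrier B" using soc_sub by auto
  have lam_E: "lam B y e \<in> U" if y: "y \<in> S" and e: "e \<in> E" for y e
  proof -
    obtain s t where st: "s \<in> S \<inter> socle B" "t \<in> T0" "y = s \<oplus> t" using cover y by blast
    have c: "s \<in> carrier B" "t \<in> carrier B" "e \<in> carrier B" using st e E T0 sub by auto
    have "lam B y e = lam B s (lam B t e)" using st c by (simp add: socle_add_mult lam_mult)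
    also have "\<dots> = lam B t e" using st c by (simp add: socle_eq lam_closed)
    finally show ?thesis using st e by (auto simp: U_def T_def)
  qed
  have lam_U: "lam B y ` U \<subseteq> U" if y: "y \<in> S" for y
  proof
    fix v assume "v \<in> lam B y ` U"
    then obtain t e where te: "t \<in> T" "e \<in> E" "v = lam B y (lam B t e)" by (auto simp: U_def)
    then have "v = lam B (y \<otimes> t) e" using y T E sub by (subst lam_mult) auto
    then show "v \<in> U" using lam_E[of "y \<otimes> t" e] te y T S_mult by auto
  qed
  define A where "A = generate (add_monoid B) U"
  have A: "subgroup A (add_monoid B)" unfolding A_def using add.generate_is_subgroup Uc by simp
  have A_sub: "A \<subseteq> S \<inter> socle B" unfolding A_def by (rule add.generate_subgroup_incl[OF U(2) I_sub])
  have A_add: "x \<oplus> y \<in> A" if "x \<in> A" "y \<in> A" for x y using subgroup.m_closed[OF A that] by simp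
  have A_minus: "\<ominus> x \<in> A" if "x \<in> A" for x using subgroup.m_inv_closed[OF A that] by (simp add: a_inv_def)
  have A_zero: "\<zero> \<in> A" using subgroup.one_closed[OF A] by simp
  have A_lam: "lam B y a \<in> A" if y: "y \<in> S" and a: "a \<in> A" for y a
  proof -
    have "lam B y ` A = generate (add_monoid B) (lam B y ` U)"
      unfolding A_def using group_hom.generate_img[OF lam_group_hom, of y U] y sub Uc by auto
    also have "\<dots> \<subseteq> A" unfolding A_def by (rule add.mono_generate[OF lam_U[OF y]])
    finally show ?thesis using a by auto
  qed
  have E_A: "E \<subseteq> A"
  proof
    fix e assume e: "e \<in> E"
    then have "e = lam B \<zero> e" using E soc_sub lam_one[of e] by (auto simp: one_eq_zero)
    then show "e \<in> A" using lam_E[OF S_zero e] by (auto simp: A_def intro: generate.incl)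
  qed
  define R where "R = (\<lambda>(a, t). a \<oplus> t) ` (A \<times> T)"
  have RI: "a \<oplus> t \<in> R" if "a \<in> A" "t \<in> T" for a t using that by (auto simp: R_def)
  have R_W: "a \<oplus> w \<in> R" if a: "a \<in> A" and w: "w \<in> W" for a w
  proof -
    obtain e t where et: "e \<in> E" "t \<in> T" "w = e \<oplus> t" using W_E[OF w] by blast
    have "a \<oplus> w = (a \<oplus> e) \<oplus> t" using et a A_sub E T sub by (simp add: subset_iff a_ass)
    then show ?thesis using RI[of "a \<oplus> e" t] A_add a et E_A by auto
  qed
  have WI: "t \<oplus> u \<in> W" "t \<otimes> u \<in> W" "\<ominus> t \<in> W" "inv t \<in> W" if "t \<in> T" "u \<in> T" for t u
    using that by (force simp: W_def)+
  have Ac: "a \<in> carrier B" "a \<in> socle B" if "a \<in> A" for a using that A_sub soc_sub by auto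
  have Tc: "t \<in> carrier B" "t \<in> S" if "t \<in> T" for t using that T sub by auto
  have R_sub: "R \<subseteq> S" using A_sub T S_add by (auto simp: R_def)
  have "subgroup R (add_monoid B)"
  proof (rule subgroup.intro)
    fix x y assume "x \<in> R" "y \<in> R"
    then obtain a t b u where *: "a \<in> A" "t \<in> T" "x = a \<oplus> t" "b \<in> A" "u \<in> T" "y = b \<oplus> u"
      by (auto simp: R_def)
    have "x \<oplus> y = a \<oplus> (t \<oplus> b) \<oplus> u" using * Ac Tc by (simp add: a_ass a_simps)
    also have "t \<oplus> b = b \<oplus> t" using * Ac Tc soc_comm[of b t] by simp
    also have "a \<oplus> (b \<oplus> t) \<oplus> u = (a \<oplus> b) \<oplus> (t \<oplus> u)"
      using * Ac Tc by (simp add: a_ass a_simps)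
    finally show "x \<otimes>\<^bsub>add_monoid B\<^esub> y \<in> R" using R_W WI * A_add by simp
  next
    fix x assume "x \<in> R"
    then obtain a t where *: "a \<in> A" "t \<in> T" "x = a \<oplus> t" by (auto simp: R_def)
    have "\<ominus> x = \<ominus> a \<oplus> \<ominus> t"
      using * Ac Tc A_minus soc_comm[of "\<ominus> a" "\<ominus> t"] by (simp add: minus_minus_add n_closed)
    then show "inv\<^bsub>add_monoid B\<^esub> x \<in> R" using R_W[of "\<ominus> a" "\<ominus> t"] WI * A_minus by (simp add: a_inv_def)
  next
    show "\<one>\<^bsub>add_monoid B\<^esub> \<in> R" using RI[OF A_zero T(3)] by (simp add: a_simps)
  qed (use R_sub sub in auto)
  moreover have "subgroup R B"
  proof (rule subgroup.intro)
    fix x y assume "x \<in> R" "y \<in> R"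
    then obtain a t b u where *: "a \<in> A" "t \<in> T" "x = a \<oplus> t" "b \<in> A" "u \<in> T" "y = b \<oplus> u"
      by (auto simp: R_def)
    define b' where "b' = lam B t b"
    have b': "b' \<in> A" using * A_lam Tc by (simp add: b'_def)
    have "t \<otimes> b = b' \<otimes> t"
      using * b' Ac Tc soc_comm[of b' t] socle_add_mult[of b' t] mult_eq[of t b] by (simp add: b'_def)
    then have "x \<otimes> y = a \<otimes> (b' \<otimes> (t \<otimes> u))"
      using * b' Ac Tc by (simp add: socle_add_mult m_assoc) (simp add: m_assoc[symmetric])
    also have "\<dots> = (a \<oplus> b') \<oplus> (t \<otimes> u)"
      using * b' Ac Tc by (simp add: socle_add_mult[symmetric] a_ass a_simps)
    finally show "x \<otimes> y \<in> R" using R_W WI * A_add b' by simp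
  next
    fix x assume "x \<in> R"
    then obtain a t where *: "a \<in> A" "t \<in> T" "x = a \<oplus> t" by (auto simp: R_def)
    have "\<ominus> a \<otimes> a = \<one>"
      using * Ac A_minus socle_add_mult[of "\<ominus> a" a] by (simp add: a_simps one_eq_zero)
    then have inv_a: "inv a = \<ominus> a" using * Ac A_minus by (simp add: inv_equality)
    define b where "b = lam B (inv t) (\<ominus> a)"
    have b: "b \<in> A" using * A_lam A_minus S_inv Tc by (simp add: b_def)
    have "inv x = inv t \<otimes> \<ominus> a"
      using * Ac Tc by (simp add: socle_add_mult inv_mult_group inv_a)
    also have "\<dots> = b \<oplus> inv t"
      using * b Ac Tc A_minus soc_comm[of b "inv t"] mult_eq[of "inv t" "\<ominus> a"] by (simp add: b_def)
    finally show "inv x \<in> R" using R_W[OF b] WI * by simp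
  next
    show "\<one> \<in> R" using RI[OF A_zero T(3)] by (simp add: a_simps one_eq_zero)
  qed (use R_sub sub in auto)
  moreover have "F \<subseteq> R"
  proof
    fix f assume f: "f \<in> F"
    then have "f \<in> T" by (simp add: T_def)
    then show "f \<in> R" using RI[OF A_zero, of f] Tc by (simp add: lz)
  qed
  ultimately have "R = S" using R_sub gen by (simp add: sub_skew_brace_def)
  define V where "V = U \<union> (T \<inter> socle B)"
  have V: "finite V" "V \<subseteq> S \<inter> socle B" using U T by (auto simp: V_def)
  have "S \<inter> socle B \<subseteq> generate (add_monoid B) V"
  proof
    fix s assume s: "s \<in> S \<inter> socle B"
    then obtain a t where *: "a \<in> A" "t \<in> T" "s = a \<oplus> t" using \<open>R = S\<close> by (auto simp: R_def)
    have "t = \<ominus> a \<oplus> s" using * Ac Tc by (simp add: ln2)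
    moreover have "\<ominus> a \<oplus> s \<in> S \<inter> socle B"
      using subgroup.m_closed[OF I_sub, of "\<ominus> a" s] A_minus * A_sub s by auto
    ultimately have "t \<in> V" using * by (simp add: V_def)
    moreover have "a \<in> generate (add_monoid B) V"
      using * add.mono_generate[of U V] by (auto simp: A_def V_def)
    ultimately show "s \<in> generate (add_monoid B) V"
      using * generate.eng[of a "add_monoid B" V t] by (auto intro: generate.incl)
  qed
  then show ?thesis using V add.generate_subgroup_incl[OF V(2) I_sub] by blast
qed

text \<open>
  On the invariant subgroup \<open>L \<inter> Soc(B)\<close> conjugation is trivial and \<open>\<lambda>\<close> is given by
  automorphisms of finite order of a finitely generated abelian group.
\<close>
lemma finite_theta_class_in_socle_part:
  assumes L: "strong_left_ideal L B" and V: "finite V" "generate (add_monoid B) V = L \<inter> socle B"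
    and Vsub: "V \<subseteq> L \<inter> socle B"
    and ord: "\<And>b. b \<in> carrier B \<Longrightarrow> lam_finite_order B b" and s: "s \<in> L \<inter> socle B"
  shows "finite (theta_class B s)"
    and "finite {t \<in> L \<inter> socle B. \<exists>n::nat>0. multiple n t = \<zero>}"
proof -
  let ?S = "L \<inter> socle B"
  let ?A = "add_monoid B\<lparr>carrier := ?S\<rparr>"
  have slS: "strong_left_ideal (socle B) B" using socle_ideal by (simp add: skew_brace_ideal_def)
  have "subgroup L (add_monoid B)" "subgroup (socle B) (add_monoid B)"
    using L slS by (auto simp: strong_left_ideal_def normal_imp_subgroup)
  then have I_sub: "subgroup ?S (add_monoid B)" by (rule add.subgroups_Inter_pair)
  have sub: "?S \<subseteq> carrier B" using subgroup.subset[OF I_sub] by simp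
  have comm: "z \<oplus> y = y \<oplus> z" if "z \<in> socle B" "y \<in> carrier B" for z y
    using that by (simp add: socle_eq)
  have "group ?A" by (rule add.subgroup_imp_group[OF I_sub])
  then interpret A: comm_group ?A
    by (rule group.group_comm_groupI) (use comm sub in auto)
  have genA: "generate ?A V = carrier ?A" using add.generate_consistent[OF Vsub I_sub] V(2) by simp
  have VA: "V \<subseteq> carrier ?A" using Vsub by simp
  have inv: "lam B b z \<in> ?S" if "b \<in> carrier B" "z \<in> ?S" for b z
    using that L slS unfolding strong_left_ideal_def by blast
  have funpow: "(lam B b ^^ n) z = lam B (b [^] n) z" if "b \<in> carrier B" "z \<in> carrier B" for b z n
  proof (induction n)
    case (Suc n)
    have "b [^] Suc n = b \<otimes> b [^] n" by (rule nat_pow_Suc2[OF that(1)])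
    then show ?case using Suc that by (simp add: lam_mult del: nat_pow_Suc)
  qed (use that in \<open>simp add: lam_one\<close>)
  have "finite ((\<lambda>f. f s) ` (lam B ` carrier B))"
  proof (rule A.finite_orbit_of_torsion_automorphisms[OF V(1) VA genA])
    fix f assume "f \<in> lam B ` carrier B"
    then obtain b where b: "b \<in> carrier B" "f = lam B b" by auto
    show "f \<in> hom ?A ?A" using b inv sub by (auto simp: hom_def lam_add subset_iff)
    show "\<exists>n>0. \<forall>a\<in>carrier ?A. (f ^^ n) a = a"
    proof -
      obtain n :: nat where "n > 0" "\<forall>x\<in>carrier B. lam B (b [^] n) x = x"
        using ord[OF b(1)] lam_finite_order_iff[OF b(1)] by blast
      then show ?thesis using funpow[OF b(1)] b(2) sub by (intro exI[of _ n]) auto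
    qed
  next
    fix f g assume "f \<in> lam B ` carrier B" "g \<in> lam B ` carrier B"
    then obtain b c where bc: "b \<in> carrier B" "f = lam B b" "c \<in> carrier B" "g = lam B c" by auto
    show "\<exists>h\<in>lam B ` carrier B. \<forall>a\<in>carrier ?A. g a = f (h a)"
      using bc sub by (intro bexI[of _ "lam B (inv b \<otimes> c)"]) (auto simp: lam_mult lam_closed lam_lam_inv)
  qed (use s in simp)
  moreover have "theta_class B s \<subseteq> (\<lambda>f. f s) ` (lam B ` carrier B)"
  proof
    fix y assume "y \<in> theta_class B s"
    then obtain a b where ab: "a \<in> carrier B" "b \<in> carrier B" "y = theta B a b s"
      by (auto simp: theta_class_def)
    have "lam B b s \<in> socle B" "lam B b s \<in> carrier B" using inv[OF ab(2) s] sub by auto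
    then have "y = lam B b s"
      using ab comm[of "lam B b s" a] by (simp add: theta_eq) (metis a_ass n_closed rn rz)
    then show "y \<in> (\<lambda>f. f s) ` (lam B ` carrier B)" using ab by blast
  qed
  ultimately show "finite (theta_class B s)" by (rule finite_subset[rotated])
  have "{t \<in> ?S. \<exists>n::nat>0. multiple n t = \<zero>} \<subseteq> {t \<in> generate ?A V. \<exists>n::int. n \<noteq> 0 \<and> t [^]\<^bsub>?A\<^esub> n = \<one>\<^bsub>?A\<^esub>}"
  proof
    fix t assume "t \<in> {t \<in> ?S. \<exists>n::nat>0. multiple n t = \<zero>}"
    then obtain n :: nat where n: "t \<in> ?S" "n > 0" "multiple n t = \<zero>" by auto
    have "t [^]\<^bsub>?A\<^esub> int n = \<one>\<^bsub>?A\<^esub>"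
      using n add.nat_pow_consistent[of t n ?S] by (simp add: int_pow_int add_pow_def)
    then show "t \<in> {t \<in> generate ?A V. \<exists>n::int. n \<noteq> 0 \<and> t [^]\<^bsub>?A\<^esub> n = \<one>\<^bsub>?A\<^esub>}"
      using n genA by (auto intro!: exI[of _ "int n"])
  qed
  then show "finite {t \<in> ?S. \<exists>n::nat>0. multiple n t = \<zero>}"
    using A.finite_torsion_of_finitely_generated[OF V(1) VA] by (rule finite_subset)
qed

text \<open>
  A multiple \<open>kx\<close> lies in \<open>L \<inter> Soc(B)\<close>, so that its class is finite. If two elements of the
  class of \<open>x\<close> are congruent modulo \<open>L \<inter> Soc(B)\<close> and have the same \<open>k\<close>-fold multiple, then they
  differ by one of finitely many torsion elements.
\<close>
lemma finite_theta_class: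
  assumes x: "x \<in> carrier B"
    and fg: "\<exists>L. strong_left_ideal L B \<and> x \<in> L \<and> finitely_generated_skew_brace (B\<lparr>carrier := L\<rparr>)"
    and fin: "\<And>C. C \<in> carrier (B Quot socle B) \<Longrightarrow>
      \<exists>L. strong_left_ideal L (B Quot socle B) \<and> finite L \<and> C \<in> L"
    and ord: "\<And>b. b \<in> carrier B \<Longrightarrow> lam_finite_order B b"
  shows "finite (theta_class B x)"
proof -
  interpret Q: skew_brace "B Quot socle B" by (rule quot_socle_skew_brace)
  obtain L where L: "strong_left_ideal L B" "x \<in> L" "finitely_generated_skew_brace (B\<lparr>carrier := L\<rparr>)"
    using fg by blast
  have subL: "sub_skew_brace L B" by (rule strong_left_ideal_sub[OF L(1)])
  then have LA: "subgroup L (add_monoid B)" by (simp add: sub_skew_brace_def)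
  have Lc: "L \<subseteq> carrier B" using subgroup.subset[OF LA] by simp
  obtain F where F: "finite F" "F \<subseteq> L"
      and gen: "\<And>R. sub_skew_brace R B \<Longrightarrow> F \<subseteq> R \<Longrightarrow> R \<subseteq> L \<Longrightarrow> R = L"
    using L(3) finitely_generated_iff[OF subL] by auto
  have "(\<lambda>y. socle B +> y) ` F \<subseteq> carrier (B Quot socle B)" using F Lc by (auto simp: quot_carrier)
  then obtain M where M: "strong_left_ideal M (B Quot socle B)" "finite M" "(\<lambda>y. socle B +> y) ` F \<subseteq> M"
    using Q.finite_set_in_finite_strong_left_ideal[OF _ _ fin] F(1) by (metis finite_imageI)
  have LM: "(\<lambda>y. socle B +> y) ` L \<subseteq> M"
    by (rule quot_image_subset[OF socle_ideal subL gen F(2) Q.strong_left_ideal_sub[OF M(1)] M(3)])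
  then have "finite ((\<lambda>y. socle B +> y) ` L)" using M(2) by (rule finite_subset)
  then obtain T where T: "T \<subseteq> L" "finite T" "(\<lambda>y. socle B +> y) ` L = (\<lambda>y. socle B +> y) ` T"
    using finite_subset_image[of "(\<lambda>y. socle B +> y) ` L" "\<lambda>y. socle B +> y" L] by auto
  have coset: "\<exists>s\<in>L \<inter> socle B. y = s \<oplus> z"
    if yz: "y \<in> L" "z \<in> L" "socle B +> y = socle B +> z" for y z
  proof -
    obtain s where s: "s \<in> socle B" "y = s \<oplus> z" using quot_eqD[OF socle_ideal _ _ yz(3)] yz Lc by blast
    have "s \<in> carrier B" using s by (simp add: socle_eq)
    then have "s = y \<oplus> \<ominus> z" using s yz Lc by (auto simp: a_ass a_simps subset_iff)
    then have "s \<in> L"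
      using subgroup.m_closed[OF LA, of y "\<ominus> z"] subgroup.m_inv_closed[OF LA, of z] yz by (simp add: a_inv_def)
    then show ?thesis using s by blast
  qed
  have cover: "\<exists>s\<in>L \<inter> socle B. \<exists>t\<in>T. y = s \<oplus> t" if y: "y \<in> L" for y
  proof -
    obtain t where "t \<in> T" "socle B +> y = socle B +> t" using T(3) y by blast
    then show ?thesis using coset[OF y, of t] T(1) by blast
  qed
  obtain V where V: "finite V" "V \<subseteq> L \<inter> socle B" "generate (add_monoid B) V = L \<inter> socle B"
    using finitely_generated_socle_part[OF subL gen F T(2,1) cover] by blast
  have multiple_L: "multiple n y \<in> L" if "y \<in> L" for n y
    using that subgroup.one_closed[OF LA] subgroup.m_closed[OF LA]
    by (induction n) (auto simp: add_pow_0 add_pow_Suc)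
  obtain i j :: nat where ij: "i < j" "socle B +> multiple i x = socle B +> multiple j x"
    using nat_pigeonhole[OF M(2), of "\<lambda>i. socle B +> multiple i x"] LM multiple_L[OF L(2)]
    by (metis image_subset_iff)
  define k where "k = j - i"
  have "k > 0" using ij by (simp add: k_def)
  obtain s where s: "s \<in> L \<inter> socle B" "multiple j x = s \<oplus> multiple i x"
    using coset[OF multiple_L multiple_L ij(2)[symmetric]] L(2) by blast
  have "multiple k x \<oplus> multiple i x = multiple j x"
    using add.nat_pow_mult[of x k i] x ij(1) by (simp add: k_def add_pow_def)
  then have "multiple k x = s"
    using s add.r_cancel[of "multiple k x" "multiple i x" s] add_pow_closed[OF x] by (auto simp: socle_eq)
  then have kx: "multiple k x \<in> L \<inter> socle B" using s by simp
  define Z where "Z = theta_class B (multiple k x)"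
  have "finite Z" unfolding Z_def by (rule finite_theta_class_in_socle_part(1)[OF L(1) V(1,3,2) _ kx]) (rule ord)
  define Tor where "Tor = {t \<in> L \<inter> socle B. \<exists>n::nat>0. multiple n t = \<zero>}"
  have "finite Tor" unfolding Tor_def by (rule finite_theta_class_in_socle_part(2)[OF L(1) V(1,3,2) _ kx]) (rule ord)
  define fibre where "fibre = (\<lambda>(t, z). {y \<in> L. multiple k y = z \<and> (\<exists>s\<in>L \<inter> socle B. y = s \<oplus> t)})"
  have fin_fibre: "finite (fibre (t, z))" if t: "t \<in> L" for t z
  proof (cases "fibre (t, z) = {}")
    case False
    then obtain w r where w: "w \<in> L" "multiple k w = z" "r \<in> L \<inter> socle B" "w = r \<oplus> t"
      by (auto simp: fibre_def)
    have "fibre (t, z) \<subseteq> (\<lambda>u. u \<oplus> w) ` Tor"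
    proof
      fix y assume "y \<in> fibre (t, z)"
      then obtain s where y: "y \<in> L" "multiple k y = z" "s \<in> L \<inter> socle B" "y = s \<oplus> t"
        by (auto simp: fibre_def)
      have c: "r \<in> carrier B" "s \<in> carrier B" "t \<in> carrier B" "w \<in> carrier B" "y \<in> carrier B"
        using w y t Lc by auto
      define u where "u = s \<oplus> \<ominus> r"
      have uc: "u \<in> carrier B" using c by (simp add: u_def a_simps)
      have yu: "y = u \<oplus> w" using c w y by (simp add: u_def a_ass a_simps ln2)
      have "subgroup (L \<inter> socle B) (add_monoid B)"
        using LA socle_ideal add.subgroups_Inter_pair
        by (auto simp: skew_brace_ideal_def strong_left_ideal_def normal_imp_subgroup)
      from subgroup.m_closed[OF this y(3) subgroup.m_inv_closed[OF this w(3)]]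
      have u: "u \<in> L \<inter> socle B" by (simp add: u_def a_inv_def)
      then have "u \<oplus> w = w \<oplus> u" using c by (simp add: socle_eq)
      then have "multiple k y = multiple k u \<oplus> multiple k w"
        using add.pow_mult_distrib[of u w k] uc c by (simp add: yu add_pow_def)
      then have "multiple k u \<oplus> multiple k w = \<zero> \<oplus> multiple k w"
        using y(2) w(2) lz[OF add_pow_closed[OF c(4), of k]] by metis
      then have "multiple k u = \<zero>"
        using add.r_cancel[of "multiple k u" "multiple k w" \<zero>] uc c add_pow_closed z_closed by simp
      then have "u \<in> Tor" using u \<open>k > 0\<close> by (auto simp: Tor_def)
      then show "y \<in> (\<lambda>u. u \<oplus> w) ` Tor" using yu by blast
    qed
    then show ?thesis using \<open>finite Tor\<close> by (meson finite_imageI finite_subset)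
  qed simp
  have "theta_class B x \<subseteq> (\<Union>p\<in>T \<times> Z. fibre p)"
  proof
    fix y assume y: "y \<in> theta_class B x"
    then have yL: "y \<in> L" using theta_class_subset_strong_left_ideal[OF L(1,2)] by auto
    obtain a b where ab: "a \<in> carrier B" "b \<in> carrier B" "y = theta B a b x"
      using y by (auto simp: theta_class_def)
    then have "multiple k y \<in> Z"
      using theta_add_pow[of a b x k] theta_in_class[of a b "multiple k x"] x by (simp add: Z_def)
    moreover obtain s t where "s \<in> L \<inter> socle B" "t \<in> T" "y = s \<oplus> t" using cover[OF yL] by blast
    ultimately show "y \<in> (\<Union>p\<in>T \<times> Z. fibre p)"
      using yL by (intro UN_I[of "(t, multiple k y)"]) (auto simp: fibre_def)
  qed
  moreover have "finite (\<Union>p\<in>T \<times> Z. fibre p)"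
    using T \<open>finite Z\<close> fin_fibre by (intro finite_UN_I) auto
  ultimately show ?thesis by (rule finite_subset)
qed

end

theorem theorem5p35:
  fixes B :: "('a, 'm) ring_scheme"
  assumes "skew_brace B"
  shows "(theta_f_skew_brace B \<and> (\<forall>b \<in> carrier B. lam_finite_order B b)) \<longleftrightarrow>
    (\<forall>x \<in> carrier B. \<exists>L. strong_left_ideal L B \<and> x \<in> L \<and>
        finitely_generated_skew_brace (B\<lparr>carrier := L\<rparr>)) \<and>
    (\<forall>C \<in> carrier (B Quot socle B).
        \<exists>L. strong_left_ideal L (B Quot socle B) \<and> finite L \<and> C \<in> L)"
    (is "?lhs \<longleftrightarrow> ?fg \<and> ?fin")
proof
  interpret skew_brace B by (rule assms)
  assume ?lhs
  then have fin: "\<And>x. x \<in> carrier B \<Longrightarrow> finite (theta_class B x)"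
    and ord: "\<And>b. b \<in> carrier B \<Longrightarrow> lam_finite_order B b"
    by (auto simp: theta_f_skew_brace_def)
  show "?fg \<and> ?fin"
    using finitely_generated_strong_left_ideal_of_finite_class[OF _ fin]
      finite_strong_left_ideals_in_quotient[OF fin ord] by blast
next
  interpret skew_brace B by (rule assms)
  assume rhs: "?fg \<and> ?fin"
  have ord: "lam_finite_order B b" if b: "b \<in> carrier B" for b
    using rhs b lam_finite_order_of_finite_strong_left_ideals[OF b] by (auto simp: quot_carrier)
  have "finite (theta_class B x)" if x: "x \<in> carrier B" for x
    using rhs x by (intro finite_theta_class[OF x] ord) auto
  then show ?lhs using assms ord by (auto simp: theta_f_skew_brace_def)
qed

end
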